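(* Let $G$ be a finite, directed, strongly connected multigraph with vertex set $\{1,\ldots,m\}$, adjacency matrix $D=(d_{ij})$ and out-degrees $d_i=\sum_{j} d_{ij}$. For $i\in G$ and $h\ge 1$ let $\widetilde{\mathcal T}^h_i$ be the wired directed cover of $G$ of height $h$ with root of type $i$, with sink $s$, and let $\mathsf{RR}(\widetilde{\mathcal T}^h_i)$ be its rotor-router group. Let $F^h_{i,\downarrow}$ be the number of spanning forests of $\mathcal T^h_i$ rooted at $S=s_\downarrow\cup s^\uparrow$ which contain the edge from the root $r$ to $s_\downarrow$, and let $F^h_{i,\uparrow}$ be the number of spanning forests of $\mathcal T^h_i$ rooted at $S$ which contain a path from $r$ to $s^\uparrow$. Then for all $i\in G$ and $h\geq 1$ $$\big|\mathsf{RR}(\widetilde{\mathcal T}^h_i)\big| = F^h_{i,\downarrow}+F^h_{i,\uparrow},$$ and these numbers can be calculated recursively: for all $i\in G$, $F^1_{i,\downarrow}=1$ and $F^1_{i,\uparrow}=d_i$, and for all $h\ge 2$ $$F^h_{i,\downarrow}=\prod_{j\in G}\big(F^{h-1}_{j,\downarrow}+F^{h-1}_{j,\uparrow}\big)^{d_{ij}},\qquad F^h_{i,\uparrow}=F^h_{i,\downarrow}\sum_{j\in G}\frac{d_{ij}\,F^{h-1}_{j,\uparrow}}{F^{h-1}_{j,\downarrow}+F^{h-1}_{j,\uparrow}}.$$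
   Context: Directed cover: $d_{ij}$ is the number of directed edges from $i$ to $j$ in $G$. The directed cover $\mathcal T_i$ of $G$ is the rooted tree with vertices labelled (typed) by vertices of $G$, whose root $r$ has type $i$ and in which every vertex of type $k$ has exactly $d_{kj}$ children of type $j$, for each $j\in G$. An additional vertex $r^{(0)}$ (the ancestor of the root) is attached to $r$ by one edge. The tree is planted plane: each vertex $x$ of type $k$ has its neighbours listed in a fixed order $(x^{(0)},x^{(1)},\ldots,x^{(d_k)})$, where $x^{(0)}$ is the ancestor and the others are the children. Truncated and wired trees: $|x|$ is the graph distance from $r$ to $x$. For $h\ge1$, $\mathcal T^h_i$ is the subtree induced by the vertices with $|x|\le h$, together with $r^{(0)}$ and the edge $\{r,r^{(0)}\}$. The down and up sinks are the vertex sets $s_\downarrow=\{r^{(0)}\}$ and $s^\uparrow=\{x:|x|=h\}$, and $S=s_\downarrow\cup s^\uparrow$. The wired tree $\widetilde{\mathcal T}^h_i$ is the multigraph obtained from $\mathcal T^h_i$ by contracting $S$ to a single vertex $s$, the sink, keeping multiple edges. Forests: a spanning forest (acyclic subgraph containing all vertices) of a graph is rooted at a vertex set $S$ if every connected component of the forest contains exactly one vertex of $S$. Rotor-router group: a rotor configuration $\rho$ assigns to each non-sink vertex $x$ of the wired tree one of its incident edges (the rotor at $x$). At each step of a rotor-router walk, the particle at $x$ first advances the rotor at $x$ to the next edge in the fixed cyclic order of the edges at $x$ (given by the order of neighbours above) and then moves along the edge the rotor now points to. For a rotor configuration $\rho$, $e_x(\rho)$ is the rotor configuration obtained by starting a particle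 at $x$ and running the rotor-router walk until it reaches the sink $s$ (which always happens). A configuration is recurrent if the rotors, viewed as directed edges pointing away from their vertices, form no directed cycle, i.e. they form an oriented spanning tree rooted at $s$. Each $e_x$ permutes the set of recurrent configurations, and the rotor-router group $\mathsf{RR}$ is the (abelian) subgroup of the group of permutations of the set of recurrent configurations generated by all $e_x$ with $x$ a non-sink vertex. *)

theory Defs
  imports "HOL-Algebra.Algebra" "Graph_Theory.Digraph_Component"
begin

section \<open>Undirected multigraphs, spanning forests, contraction\<close>

text \<open>An edge with a single end is a loop.\<close>

record ('v, 'e) mgraph =
  mverts :: "'v set"
  medges :: "'e set"
  mends :: "'e \<Rightarrow> 'v set"

definition incident_edges :: "('v, 'e) mgraph \<Rightarrow> 'v \<Rightarrow> 'e set" where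
  "incident_edges M x = {e \<in> medges M. x \<in> mends M e}"

definition other_end :: "('v, 'e) mgraph \<Rightarrow> 'e \<Rightarrow> 'v \<Rightarrow> 'v" where
  "other_end M e x = (THE y. mends M e = {x, y})"

text \<open>A spanning subgraph is given by its edge set A. Loops are cycles of length 1, pairs of
  parallel edges are cycles of length 2.\<close>

definition is_cycle :: "('v, 'e) mgraph \<Rightarrow> 'e set \<Rightarrow> 'v list \<Rightarrow> 'e list \<Rightarrow> bool" where
  "is_cycle M A vs es \<longleftrightarrow>
     es \<noteq> [] \<and> length vs = length es \<and> distinct vs \<and> distinct es \<and> set es \<subseteq> A \<and>
     (\<forall>k < length es. mends M (es ! k) = {vs ! k, vs ! (Suc k mod length es)})"

definition connected_by :: "('v, 'e) mgraph \<Rightarrow> 'e set \<Rightarrow> ('v \<times> 'v) set" where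
  "connected_by M A = {(u, v). \<exists>e \<in> A. mends M e = {u, v}}\<^sup>*"

definition conn_component :: "('v, 'e) mgraph \<Rightarrow> 'e set \<Rightarrow> 'v \<Rightarrow> 'v set" where
  "conn_component M A v = {w \<in> mverts M. (v, w) \<in> connected_by M A}"

definition spanning_forest :: "('v, 'e) mgraph \<Rightarrow> 'e set \<Rightarrow> bool" where
  "spanning_forest M A \<longleftrightarrow> A \<subseteq> medges M \<and> (\<nexists>vs es. is_cycle M A vs es)"

definition rooted_at :: "('v, 'e) mgraph \<Rightarrow> 'e set \<Rightarrow> 'v set \<Rightarrow> bool" where
  "rooted_at M A S \<longleftrightarrow> (\<forall>v \<in> mverts M. \<exists>!s. s \<in> S \<inter> conn_component M A v)"

text \<open>The contracted vertex is None. The edges keep their identity, so parallel edges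
  created by the contraction stay distinct.\<close>

definition contract_vertex :: "'v set \<Rightarrow> 'v \<Rightarrow> 'v option" where
  "contract_vertex S v = (if v \<in> S then None else Some v)"

definition contract :: "('v, 'e) mgraph \<Rightarrow> 'v set \<Rightarrow> ('v option, 'e) mgraph" where
  "contract M S =
     \<lparr>mverts = insert None (Some ` (mverts M - S)), medges = medges M,
      mends = (\<lambda>e. contract_vertex S ` mends M e)\<rparr>"

section \<open>The rotor-router group of a multigraph with a sink\<close>

text \<open>The cyclic order of the edges at a non-sink vertex x is given by a list \<open>rot x\<close>
  enumerating them.\<close>

definition next_in :: "'e list \<Rightarrow> 'e \<Rightarrow> 'e" where
  "next_in es e = es ! (Suc (THE k. k < length es \<and> es ! k = e) mod length es)"

definition rotor_configs :: "('v, 'e) mgraph \<Rightarrow> 'v \<Rightarrow> ('v \<Rightarrow> 'e) set" where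
  "rotor_configs M s = (\<Pi>\<^sub>E x \<in> mverts M - {s}. incident_edges M x)"

definition rr_step ::
  "('v, 'e) mgraph \<Rightarrow> ('v \<Rightarrow> 'e list) \<Rightarrow> 'v \<times> ('v \<Rightarrow> 'e) \<Rightarrow> 'v \<times> ('v \<Rightarrow> 'e)" where
  "rr_step M rot = (\<lambda>(x, \<rho>). let e = next_in (rot x) (\<rho> x) in (other_end M e x, \<rho>(x := e)))"

definition rr_op ::
  "('v, 'e) mgraph \<Rightarrow> ('v \<Rightarrow> 'e list) \<Rightarrow> 'v \<Rightarrow> 'v \<Rightarrow> ('v \<Rightarrow> 'e) \<Rightarrow> ('v \<Rightarrow> 'e)" where
  "rr_op M rot s x \<rho> =
     (let n = (LEAST n. fst ((rr_step M rot ^^ n) (x, \<rho>)) = s)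
      in snd ((rr_step M rot ^^ n) (x, \<rho>)))"

definition recurrent_configs :: "('v, 'e) mgraph \<Rightarrow> 'v \<Rightarrow> ('v \<Rightarrow> 'e) set" where
  "recurrent_configs M s =
     {\<rho> \<in> rotor_configs M s. acyclic {(x, other_end M (\<rho> x) x) | x. x \<in> mverts M - {s}}}"

definition RR ::
  "('v, 'e) mgraph \<Rightarrow> ('v \<Rightarrow> 'e list) \<Rightarrow> 'v \<Rightarrow> (('v \<Rightarrow> 'e) \<Rightarrow> ('v \<Rightarrow> 'e)) monoid" where
  "RR M rot s =
     subgroup_generated (BijGroup (recurrent_configs M s))
       {restrict (rr_op M rot s x) (recurrent_configs M s) | x. x \<in> mverts M - {s}}"

section \<open>Directed covers\<close>

definition adj :: "('a, 'b) pre_digraph \<Rightarrow> 'a \<Rightarrow> 'a \<Rightarrow> nat" where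
  "adj G i j = card {e \<in> arcs G. tail G e = i \<and> head G e = j}"

text \<open>The vertices of the tree other than the ancestor of the root are addressed by lists of
  child numbers: the root is \<open>[]\<close> and the c-th child of x (c = 1, 2, ...) is \<open>x @ [c]\<close>; thus
  the distance of x from the root is \<open>length x\<close>. A tree together with its plane
  embedding is then given by the map t sending each vertex to its type.\<close>

datatype pvertex = Ancestor | Node "nat list"

inductive_set tree_nodes :: "('a, 'b) pre_digraph \<Rightarrow> (nat list \<Rightarrow> 'a) \<Rightarrow> nat list set"
  for G t where
  root: "[] \<in> tree_nodes G t"
| child: "x \<in> tree_nodes G t \<Longrightarrow> c \<in> {1..out_degree G (t x)} \<Longrightarrow> x @ [c] \<in> tree_nodes G t"

text \<open>The order of the children is arbitrary and may even differ between vertices of the same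
  type.\<close>

definition directed_cover :: "('a, 'b) pre_digraph \<Rightarrow> 'a \<Rightarrow> (nat list \<Rightarrow> 'a) \<Rightarrow> bool" where
  "directed_cover G i t \<longleftrightarrow> t [] = i \<and>
     (\<forall>x \<in> tree_nodes G t. \<forall>j \<in> verts G.
        card {c \<in> {1..out_degree G (t x)}. t (x @ [c]) = j} = adj G (t x) j)"

fun neighbour :: "nat list \<Rightarrow> nat \<Rightarrow> pvertex" where
  "neighbour x 0 = (if x = [] then Ancestor else Node (butlast x))"
| "neighbour x (Suc c) = Node (x @ [Suc c])"

definition trunc_nodes :: "('a, 'b) pre_digraph \<Rightarrow> (nat list \<Rightarrow> 'a) \<Rightarrow> nat \<Rightarrow> nat list set" where
  "trunc_nodes G t h = {x \<in> tree_nodes G t. length x \<le> h}"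

text \<open>Each vertex of the truncated tree contributes the edge to its ancestor.\<close>

definition trunc_tree ::
  "('a, 'b) pre_digraph \<Rightarrow> (nat list \<Rightarrow> 'a) \<Rightarrow> nat \<Rightarrow> (pvertex, pvertex set) mgraph" where
  "trunc_tree G t h =
     \<lparr>mverts = insert Ancestor (Node ` trunc_nodes G t h),
      medges = {{Node x, neighbour x 0} | x. x \<in> trunc_nodes G t h},
      mends = (\<lambda>e. e)\<rparr>"

definition down_sink :: "pvertex set" where
  "down_sink = {Ancestor}"

definition up_sink :: "('a, 'b) pre_digraph \<Rightarrow> (nat list \<Rightarrow> 'a) \<Rightarrow> nat \<Rightarrow> pvertex set" where
  "up_sink G t h = Node ` {x \<in> tree_nodes G t. length x = h}"

definition sinks :: "('a, 'b) pre_digraph \<Rightarrow> (nat list \<Rightarrow> 'a) \<Rightarrow> nat \<Rightarrow> pvertex set" where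
  "sinks G t h = down_sink \<union> up_sink G t h"

text \<open>The sink s of the wired tree is None.\<close>

definition wired_tree ::
  "('a, 'b) pre_digraph \<Rightarrow> (nat list \<Rightarrow> 'a) \<Rightarrow> nat \<Rightarrow> (pvertex option, pvertex set) mgraph" where
  "wired_tree G t h = contract (trunc_tree G t h) (sinks G t h)"

text \<open>Only the values at non-sink vertices matter; the other cases are junk.\<close>

fun edge_order ::
  "('a, 'b) pre_digraph \<Rightarrow> (nat list \<Rightarrow> 'a) \<Rightarrow> pvertex option \<Rightarrow> pvertex set list" where
  "edge_order G t (Some (Node x)) =
     map (\<lambda>c. {Node x, neighbour x c}) [0..<Suc (out_degree G (t x))]"
| "edge_order G t _ = []"

definition RR_wired ::
  "('a, 'b) pre_digraph \<Rightarrow> (nat list \<Rightarrow> 'a) \<Rightarrow> nat \<Rightarrow>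
     ((pvertex option \<Rightarrow> pvertex set) \<Rightarrow> (pvertex option \<Rightarrow> pvertex set)) monoid" where
  "RR_wired G t h = RR (wired_tree G t h) (edge_order G t) None"

definition F_down :: "('a, 'b) pre_digraph \<Rightarrow> (nat list \<Rightarrow> 'a) \<Rightarrow> nat \<Rightarrow> nat" where
  "F_down G t h =
     card {A. spanning_forest (trunc_tree G t h) A \<and> rooted_at (trunc_tree G t h) A (sinks G t h) \<and>
              {Node [], Ancestor} \<in> A}"

definition F_up :: "('a, 'b) pre_digraph \<Rightarrow> (nat list \<Rightarrow> 'a) \<Rightarrow> nat \<Rightarrow> nat" where
  "F_up G t h =
     card {A. spanning_forest (trunc_tree G t h) A \<and> rooted_at (trunc_tree G t h) A (sinks G t h) \<and>
              (\<exists>s \<in> up_sink G t h. (Node [], s) \<in> connected_by (trunc_tree G t h) A)}"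

section \<open>Out-degrees and existence of directed covers\<close>

lemma (in fin_digraph) out_degree_eq_sum_adj:
  "out_degree G i = (\<Sum>j \<in> verts G. adj G i j)"
proof -
  have "out_arcs G i = (\<Union>j \<in> verts G. {e \<in> arcs G. tail G e = i \<and> head G e = j})"
    by (auto simp: out_arcs_def)
  then have "out_degree G i = card (\<Union>j \<in> verts G. {e \<in> arcs G. tail G e = i \<and> head G e = j})"
    by (simp add: out_degree_def)
  also have "\<dots> = (\<Sum>j \<in> verts G. adj G i j)"
    unfolding adj_def by (rule card_UN_disjoint) auto
  finally show ?thesis .
qed

lemma image_Collect_restrict: "f ` {c \<in> A. P (f c)} = {e \<in> f ` A. P e}"
  by auto

lemma (in fin_digraph) ex_directed_cover:
  "\<exists>t. directed_cover G i t"
proof -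
  have "\<exists>f. bij_betw f {1..out_degree G k} (out_arcs G k)" for k
    by (rule finite_same_card_bij) (auto simp: out_degree_def)
  then obtain f where f: "\<And>k. bij_betw (f k) {1..out_degree G k} (out_arcs G k)"
    by metis
  define t where "t x = foldl (\<lambda>k c. head G (f k c)) i x" for x
  have "card {c \<in> {1..out_degree G (t x)}. t (x @ [c]) = j} = adj G (t x) j" for x j
  proof -
    have "bij_betw (f (t x)) {c \<in> {1..out_degree G (t x)}. t (x @ [c]) = j}
            {e \<in> arcs G. tail G e = t x \<and> head G e = j}"
    proof (rule bij_betw_subset[OF f[of "t x"]])
      have img: "f (t x) ` {1..out_degree G (t x)} = out_arcs G (t x)"
        using f[of "t x"] by (rule bij_betw_imp_surj_on)
      have "f (t x) ` {c \<in> {1..out_degree G (t x)}. head G (f (t x) c) = j} =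
          {e \<in> f (t x) ` {1..out_degree G (t x)}. head G e = j}"
        by (rule image_Collect_restrict)
      then show "f (t x) ` {c \<in> {1..out_degree G (t x)}. t (x @ [c]) = j} =
          {e \<in> arcs G. tail G e = t x \<and> head G e = j}"
        unfolding img by (simp add: t_def out_arcs_def)
    qed auto
    then show ?thesis
      unfolding adj_def by (rule bij_betw_same_card)
  qed
  then have "directed_cover G i t"
    by (simp add: directed_cover_def t_def)
  then show ?thesis by (rule exI[where x = t])
qed

end

theory Submission
  imports Defs
begin

text \<open>The order of the rotor-router group is the number of acyclic rotor configurations, because the
  group acts simply transitively on them; on the wired tree these configurations correspond to the
  rooted spanning forests, and both are counted by cutting the tree at its root.

  The group. A rotor-router walk is a special case of a process with many chips, in which any
  vertex holding a chip may fire: it advances its rotor and sends the chip along. What happens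
  depends only on the odometer u, which counts how often each vertex has fired. Hence the final
  rotors do not depend on the order of the firings (least action principle, lemma
  \<open>legal_le_stabilizing\<close>), and routing \<open>\<sigma> + \<tau>\<close> chips is the same as
  routing \<open>\<sigma>\<close> and then \<open>\<tau>\<close> (lemma \<open>route_add\<close>). So the operators
  \<open>route \<sigma>\<close> form a commutative monoid that contains the walks \<open>e_x\<close>. Everything else
  comes from a strictly superharmonic function \<open>\<kappa>\<close> on the graph, vanishing at the sink.
  If each vertex x fires \<open>\<kappa>(x) deg(x)\<close> times, its rotor makes \<open>\<kappa>(x)\<close> full turns, and
  the net effect is to take a positive number of chips from every vertex, namely the value of the
  Laplacian of \<open>\<kappa>\<close>. This bounds all odometers, so the process terminates. Moreover, on an
  acyclic configuration exactly this many firings happen when the same number of chips is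
  placed (lemma \<open>route_burn\<close>, a form of Dhar's burning test), so routing this chip
  configuration, which is positive everywhere, is the identity. Therefore every
  \<open>route \<sigma>\<close> is invertible on acyclic configurations. Any two configurations \<open>\<rho>\<close>
  and \<open>\<rho>'\<close> are joined by turning each rotor of \<open>\<rho>\<close> until it agrees with
  \<open>\<rho>'\<close>, which gives transitivity; and a commutative transitive group of permutations
  acts freely.

  The tree. A pointing chooses for each non-sink node its parent or one of its children, such that
  no node and child choose each other. In a tree two-cycles are the only possible cycles, so
  pointings are the acyclic rotor configurations. The chosen edges form a rooted spanning
  forest, in which every node is connected to the sink that it reaches by following the pointing;
  conversely each node of a rooted forest points towards its sink. The root points to the ancestor
  exactly if the forest contains that edge, and otherwise the root is connected to an upper sink.

  The recursion. Fix the choice of the root. What remains is a pointing of each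
  subtree below the root; the only condition is that a child to which the root points must
  not point back. This yields a product over the children if the root points to its ancestor,
  and a sum of such products, one for each child, otherwise. Grouping the children by their type
  gives the formulas. It also shows by induction that the counts depend only on the type of the
  root, not on the order in which the children of the nodes are listed.\<close>

section \<open>Turning a rotor\<close>

lemma next_in_nth:
  assumes "distinct es" "i < length es"
  shows "next_in es (es ! i) = es ! (Suc i mod length es)"
proof -
  have "(THE k. k < length es \<and> es ! k = es ! i) = i"
    using assms by (intro the_equality) (auto simp: nth_eq_iff_index_eq)
  then show ?thesis by (simp add: next_in_def)
qed

lemma next_in_funpow_nth:
  assumes "distinct es" "i < length es"
  shows "(next_in es ^^ n) (es ! i) = es ! ((i + n) mod length es)"
proof (induction n)
  case 0
  then show ?case using assms by simp
next
  case (Suc n)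
  have "(i + n) mod length es < length es" using assms(2) by (intro mod_less_divisor) auto
  then show ?case using Suc by (simp add: next_in_nth[OF assms(1)] mod_Suc_eq)
qed

lemma next_in_funpow_in_set:
  assumes "distinct es" "e \<in> set es"
  shows "(next_in es ^^ n) e \<in> set es"
proof -
  obtain i where "i < length es" "e = es ! i" using assms(2) by (auto simp: in_set_conv_nth)
  then show ?thesis
    using next_in_funpow_nth[OF assms(1)] by (auto intro!: nth_mem mod_less_divisor)
qed

lemma next_in_reaches:
  assumes "distinct es" "e \<in> set es" "e' \<in> set es"
  obtains n where "(next_in es ^^ n) e = e'"
proof -
  obtain i j where ij: "i < length es" "e = es ! i" "j < length es" "e' = es ! j"
    using assms(2,3) by (auto simp: in_set_conv_nth)
  have "(next_in es ^^ (j + length es - i)) e = e'"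
    using ij next_in_funpow_nth[OF assms(1) ij(1), of "j + length es - i"] by simp
  then show thesis by (rule that)
qed

lemma next_in_full_turn:
  assumes "distinct es" "e \<in> set es"
  shows "(next_in es ^^ (q * length es)) e = e"
proof -
  obtain i where "i < length es" "e = es ! i" using assms(2) by (auto simp: in_set_conv_nth)
  then show ?thesis
    using next_in_funpow_nth[OF assms(1), of i "q * length es"] by simp
qed

lemma sum_lessThan_add:
  fixes f :: "nat \<Rightarrow> nat"
  shows "(\<Sum>k<m + n. f k) = (\<Sum>k<m. f k) + (\<Sum>k<n. f (m + k))"
  by (induction n) auto

lemma funpow_Suc_add: "(f ^^ Suc (m + k)) x = (f ^^ Suc k) ((f ^^ m) x)"
  by (metis add.commute add_Suc funpow_add o_apply)

lemma sum_full_turn: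
  fixes g :: "'e \<Rightarrow> nat"
  assumes "distinct es" "e \<in> set es"
  shows "(\<Sum>k<length es. g ((next_in es ^^ Suc k) e)) = (\<Sum>e'\<in>set es. g e')"
proof -
  let ?f = "\<lambda>k. (next_in es ^^ Suc k) e"
  obtain i where i: "i < length es" "e = es ! i" using assms(2) by (auto simp: in_set_conv_nth)
  have "set es \<subseteq> ?f ` {..<length es}"
  proof
    fix e' assume "e' \<in> set es"
    then obtain j where j: "j < length es" "e' = es ! j" by (auto simp: in_set_conv_nth)
    define k where "k = (j + length es - Suc i) mod length es"
    have "(i + Suc k) mod length es = (Suc i + (j + length es - Suc i)) mod length es"
      unfolding k_def add_Suc_shift[symmetric] by (rule mod_add_right_eq)
    also have "Suc i + (j + length es - Suc i) = j + length es" using i(1) by simp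
    also have "(j + length es) mod length es = j" using j(1) by simp
    finally have "?f k = e'"
      using j(2) unfolding i(2) next_in_funpow_nth[OF assms(1) i(1)] by simp
    moreover have "k < length es" unfolding k_def using i(1) by (intro mod_less_divisor) auto
    ultimately show "e' \<in> ?f ` {..<length es}" by blast
  qed
  moreover have "?f ` {..<length es} \<subseteq> set es"
    using next_in_funpow_in_set[OF assms] by blast
  ultimately have "?f ` {..<length es} = set es" by (rule equalityI[rotated])
  then have "bij_betw ?f {..<length es} (set es)"
    using assms(1) by (intro bij_betw_imageI eq_card_imp_inj_on) (auto simp: distinct_card)
  then show ?thesis by (rule sum.reindex_bij_betw)
qed

lemma sum_full_turns:
  fixes g :: "'e \<Rightarrow> nat"
  assumes "distinct es" "e \<in> set es"
  shows "(\<Sum>k<q * length es. g ((next_in es ^^ Suc k) e)) = q * (\<Sum>e'\<in>set es. g e')"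
proof (induction q)
  case (Suc q)
  have "(\<Sum>k<Suc q * length es. g ((next_in es ^^ Suc k) e)) =
      (\<Sum>k<q * length es + length es. g ((next_in es ^^ Suc k) e))"
    by (simp add: add.commute)
  also have "\<dots> = q * (\<Sum>e'\<in>set es. g e') +
      (\<Sum>k<length es. g ((next_in es ^^ Suc k) ((next_in es ^^ (q * length es)) e)))"
    unfolding sum_lessThan_add Suc funpow_Suc_add ..
  finally show ?case by (simp only: next_in_full_turn[OF assms] sum_full_turn[OF assms]) simp
qed simp

section \<open>Acyclic functional graphs, ends and connectivity\<close>

text \<open>Cycles in the graph of a function are awkward to handle directly. The
  arguments below use sets closed under the function instead.\<close>

lemma acyclic_graph_iff_no_trap:
  assumes "finite V"
  shows "acyclic {(x, f x) | x. x \<in> V} \<longleftrightarrow> (\<forall>C\<subseteq>V. C \<noteq> {} \<longrightarrow> (\<exists>x\<in>C. f x \<notin> C))"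
proof
  let ?R = "{(x, f x) | x. x \<in> V}"
  assume "acyclic ?R"
  moreover have "finite ?R" using assms by simp
  ultimately have wf: "wf (?R\<inverse>)" by (rule finite_acyclic_wf_converse[rotated])
  show "\<forall>C\<subseteq>V. C \<noteq> {} \<longrightarrow> (\<exists>x\<in>C. f x \<notin> C)"
  proof (intro allI impI)
    fix C assume C: "C \<subseteq> V" "C \<noteq> {}"
    obtain z where "z \<in> C" "\<And>y. (y, z) \<in> ?R\<inverse> \<Longrightarrow> y \<notin> C"
      using wfE_min'[OF wf C(2)] by blast
    then show "\<exists>x\<in>C. f x \<notin> C" using C(1) by blast
  qed
next
  let ?R = "{(x, f x) | x. x \<in> V}"
  assume no_trap: "\<forall>C\<subseteq>V. C \<noteq> {} \<longrightarrow> (\<exists>x\<in>C. f x \<notin> C)"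
  define C where "C = {x. (x, x) \<in> ?R\<^sup>+}"
  have C: "x \<in> V \<and> f x \<in> C" if "x \<in> C" for x
  proof -
    have "(x, x) \<in> ?R\<^sup>+" using that by (simp add: C_def)
    from tranclD[OF this] obtain z where z: "(x, z) \<in> ?R" "(z, x) \<in> ?R\<^sup>*" by blast
    then have "(z, z) \<in> ?R\<^sup>+" by (meson rtrancl_into_trancl1)
    then show ?thesis using z(1) by (auto simp: C_def)
  qed
  then have "C = {}" using no_trap by blast
  then show "acyclic ?R" by (auto simp: acyclic_def C_def)
qed

lemma other_end_eq:
  assumes "mends M e = {x, y}"
  shows "other_end M e x = y"
  unfolding other_end_def assms by (rule the_equality) (auto simp: doubleton_eq_iff)

lemma connected_sym: "(u, v) \<in> connected_by M A \<Longrightarrow> (v, u) \<in> connected_by M A"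
  unfolding connected_by_def
  by (rule symD[OF sym_rtrancl]) (auto simp: sym_def insert_commute)

lemma connected_trans:
  "(u, v) \<in> connected_by M A \<Longrightarrow> (v, w) \<in> connected_by M A \<Longrightarrow> (u, w) \<in> connected_by M A"
  unfolding connected_by_def by (rule rtrancl_trans)

lemma connected_mono: "A \<subseteq> A' \<Longrightarrow> (u, v) \<in> connected_by M A \<Longrightarrow> (u, v) \<in> connected_by M A'"
  unfolding connected_by_def by (erule rtrancl_mono[THEN subsetD, rotated]) blast

lemma connected_edge: "e \<in> A \<Longrightarrow> mends M e = {u, v} \<Longrightarrow> (u, v) \<in> connected_by M A"
  unfolding connected_by_def by blast

section \<open>Firing and the abelian property\<close>

text \<open>The function kappa is strictly superharmonic away from the sink: its average over the
  neighbours of x is less than its value at x. It exists only if the sink can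
  be reached from every vertex, since it cannot attain its minimum over a component without the
  sink, and it bounds how often the vertices fire.\<close>

locale rotor_router =
  fixes M :: "('v, 'e) mgraph" and s :: 'v and rot :: "'v \<Rightarrow> 'e list" and kappa :: "'v \<Rightarrow> nat"
  assumes finite_verts: "finite (mverts M)"
    and ends: "e \<in> medges M \<Longrightarrow> \<exists>u\<in>mverts M. \<exists>v\<in>mverts M. mends M e = {u, v}"
    and distinct_rot: "x \<in> mverts M - {s} \<Longrightarrow> distinct (rot x)"
    and set_rot: "x \<in> mverts M - {s} \<Longrightarrow> set (rot x) = incident_edges M x"
    and kappa_sink: "kappa s = 0"
    and superharmonic: "x \<in> mverts M - {s} \<Longrightarrow>
      (\<Sum>e\<in>incident_edges M x. kappa (other_end M e x)) < kappa x * length (rot x)"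
begin

definition V :: "'v set" where "V = mverts M - {s}"

abbreviation dest :: "'v \<Rightarrow> 'e \<Rightarrow> 'v" where "dest x e \<equiv> other_end M e x"

text \<open>Here and below u is an odometer: every vertex x has fired \<open>u x\<close> times. The order of the
  firings does not affect the resulting rotors and chips, so it does not occur.\<close>

definition turn :: "('v \<Rightarrow> 'e) \<Rightarrow> ('v \<Rightarrow> nat) \<Rightarrow> 'v \<Rightarrow> 'e" where
  "turn \<rho> u = (\<lambda>x. (next_in (rot x) ^^ u x) (\<rho> x))"

definition inflow :: "('v \<Rightarrow> 'e) \<Rightarrow> ('v \<Rightarrow> nat) \<Rightarrow> 'v \<Rightarrow> nat" where
  "inflow \<rho> u y = (\<Sum>x\<in>V. \<Sum>k<u x. of_bool (dest x ((next_in (rot x) ^^ Suc k) (\<rho> x)) = y))"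

text \<open>The number is signed since u may fire vertices that have no chip.\<close>

definition chips :: "('v \<Rightarrow> nat) \<Rightarrow> ('v \<Rightarrow> 'e) \<Rightarrow> ('v \<Rightarrow> nat) \<Rightarrow> 'v \<Rightarrow> int" where
  "chips \<sigma> \<rho> u y = int (\<sigma> y) - int (u y) + int (inflow \<rho> u y)"

inductive legal :: "('v \<Rightarrow> nat) \<Rightarrow> ('v \<Rightarrow> 'e) \<Rightarrow> ('v \<Rightarrow> nat) \<Rightarrow> bool" for \<sigma> \<rho> where
  legal_0: "legal \<sigma> \<rho> (\<lambda>_. 0)"
| legal_fire: "legal \<sigma> \<rho> u \<Longrightarrow> x \<in> V \<Longrightarrow> 0 < chips \<sigma> \<rho> u x \<Longrightarrow> legal \<sigma> \<rho> (u(x := Suc (u x)))"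

definition settles :: "('v \<Rightarrow> nat) \<Rightarrow> ('v \<Rightarrow> 'e) \<Rightarrow> ('v \<Rightarrow> nat) \<Rightarrow> bool" where
  "settles \<sigma> \<rho> u \<longleftrightarrow> legal \<sigma> \<rho> u \<and> (\<forall>x\<in>V. chips \<sigma> \<rho> u x \<le> 0)"

text \<open>The rotors after \<open>\<sigma>\<close> chips have been routed to the sink, in any legal order.\<close>

definition route :: "('v \<Rightarrow> nat) \<Rightarrow> ('v \<Rightarrow> 'e) \<Rightarrow> 'v \<Rightarrow> 'e" where
  "route \<sigma> \<rho> = turn \<rho> (THE u. settles \<sigma> \<rho> u)"

abbreviation "rotors \<equiv> rotor_configs M s"

lemma finite_V: "finite V"
  using finite_verts by (simp add: V_def)

lemma rotor_in_rot: "\<rho> \<in> rotors \<Longrightarrow> x \<in> V \<Longrightarrow> \<rho> x \<in> set (rot x)"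
  using set_rot by (auto simp: rotor_configs_def V_def)

lemma rot_nonempty: "x \<in> V \<Longrightarrow> rot x \<noteq> []"
  using superharmonic[of x] by (auto simp: V_def)

lemma dest_props:
  assumes "x \<in> V" "e \<in> set (rot x)"
  shows "dest x e \<in> mverts M" "mends M e = {x, dest x e}" "e \<in> medges M"
proof -
  have e: "e \<in> medges M" "x \<in> mends M e"
    using assms set_rot by (auto simp: V_def incident_edges_def)
  then obtain u v where "u \<in> mverts M" "v \<in> mverts M" "mends M e = {u, v}" "x = u \<or> x = v"
    using ends[OF e(1)] by auto
  then obtain y where y: "mends M e = {x, y}" "y \<in> mverts M"
    by (metis insert_commute)
  have "dest x e = y" using y(1) by (rule other_end_eq)
  then show "dest x e \<in> mverts M" "mends M e = {x, dest x e}" "e \<in> medges M"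
    using y e by auto
qed

lemma turn_0 [simp]: "turn \<rho> (\<lambda>_. 0) = \<rho>"
  by (simp add: turn_def)

lemma turn_add: "turn \<rho> (\<lambda>x. u x + v x) = turn (turn \<rho> u) v"
  by (simp add: turn_def add.commute[of "u _"] funpow_add)

lemma turn_Suc:
  "turn \<rho> (u(x := Suc (u x))) = (turn \<rho> u)(x := next_in (rot x) (turn \<rho> u x))"
  by (auto simp: turn_def)

lemma inflow_add: "inflow \<rho> (\<lambda>x. u x + v x) y = inflow \<rho> u y + inflow (turn \<rho> u) v y"
proof -
  have "(next_in (rot x) ^^ Suc (u x + k)) (\<rho> x) =
      (next_in (rot x) ^^ Suc k) ((next_in (rot x) ^^ u x) (\<rho> x))" for x k
    by (rule funpow_Suc_add)
  then show ?thesis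
    unfolding inflow_def turn_def sum_lessThan_add sum.distrib by simp
qed

lemma inflow_Suc:
  assumes "x \<in> V"
  shows "inflow \<rho> (u(x := Suc (u x))) y =
    inflow \<rho> u y + of_bool (dest x (next_in (rot x) (turn \<rho> u x)) = y)"
proof -
  have "u(x := Suc (u x)) = (\<lambda>z. u z + of_bool (z = x))" by auto
  moreover have "inflow (turn \<rho> u) (\<lambda>z. of_bool (z = x)) y =
      of_bool (dest x (next_in (rot x) (turn \<rho> u x)) = y)"
  proof -
    have "(\<Sum>k<(of_bool (z = x)). of_bool (dest z ((next_in (rot z) ^^ Suc k) (turn \<rho> u z)) = y)) =
      (if z = x then of_bool (dest x (next_in (rot x) (turn \<rho> u x)) = y) else (0::nat))" for z
      by (cases "z = x") (simp_all del: sum_of_bool_eq)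
    then show ?thesis
      unfolding inflow_def using assms by (simp add: finite_V)
  qed
  ultimately show ?thesis by (simp add: inflow_add)
qed

lemma inflow_mono:
  assumes "\<And>x. x \<in> V \<Longrightarrow> u x \<le> v x"
  shows "inflow \<rho> u y \<le> inflow \<rho> v y"
  unfolding inflow_def by (intro sum_mono sum_mono2) (use assms in auto)

lemma chips_0 [simp]: "chips \<sigma> \<rho> (\<lambda>_. 0) y = int (\<sigma> y)"
  by (simp add: chips_def inflow_def)

lemma chips_Suc:
  assumes "x \<in> V"
  shows "chips \<sigma> \<rho> (u(x := Suc (u x))) y =
    chips \<sigma> \<rho> u y - of_bool (y = x) + of_bool (dest x (next_in (rot x) (turn \<rho> u x)) = y)"
  using assms by (auto simp: chips_def inflow_Suc)

lemma chips_add: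
  assumes "\<And>y. y \<in> V \<Longrightarrow> chips \<sigma> \<rho> u y = int (\<tau> y)" "y \<in> V"
  shows "chips \<sigma> \<rho> (\<lambda>x. u x + v x) y = chips \<tau> (turn \<rho> u) v y"
  using assms(1)[OF assms(2)] by (simp add: chips_def inflow_add)

lemma chips_add_initial: "chips (\<lambda>x. \<sigma> x + \<tau> x) \<rho> u y = chips \<sigma> \<rho> u y + int (\<tau> y)"
  by (simp add: chips_def)

lemma legal_outside: "legal \<sigma> \<rho> u \<Longrightarrow> x \<notin> V \<Longrightarrow> u x = 0"
  by (induction rule: legal.induct) auto

lemma legal_chips_nonneg: "legal \<sigma> \<rho> u \<Longrightarrow> 0 \<le> chips \<sigma> \<rho> u y"
proof (induction arbitrary: y rule: legal.induct)
  case (legal_fire u x)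
  show ?case
    unfolding chips_Suc[OF legal_fire.hyps(2)]
    using legal_fire.IH[of y] legal_fire.hyps(3) by (auto split: split_of_bool)
qed simp

lemma settles_chips: "settles \<sigma> \<rho> u \<Longrightarrow> x \<in> V \<Longrightarrow> chips \<sigma> \<rho> u x = 0"
  unfolding settles_def using legal_chips_nonneg by (metis order_antisym)

text \<open>Least action principle. A legal sequence of firings cannot be the first to exceed w at a vertex
  y: when \<open>u y = w y\<close>, the vertex y has received at most as many chips under u as under w, so it
  has no chip left to fire.\<close>

lemma legal_le_stabilizing:
  assumes "legal \<sigma> \<rho> u" and w: "\<And>x. x \<in> V \<Longrightarrow> chips \<sigma> \<rho> w x \<le> 0"
  shows "u x \<le> w x"
  using assms(1)
proof (induction arbitrary: x rule: legal.induct)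
  case (legal_fire u y)
  have "u y < w y"
  proof (rule ccontr)
    assume "\<not> u y < w y"
    then have "u y = w y" using legal_fire.IH[of y] by simp
    then have "chips \<sigma> \<rho> u y \<le> chips \<sigma> \<rho> w y"
      using inflow_mono[of u w \<rho> y] legal_fire.IH by (simp add: chips_def)
    then show False using legal_fire.hyps w[of y] by simp
  qed
  then show ?case using legal_fire.IH[of x] by auto
qed simp

lemma settles_unique: "settles \<sigma> \<rho> u \<Longrightarrow> settles \<sigma> \<rho> v \<Longrightarrow> u = v"
  unfolding settles_def by (intro ext order_antisym) (blast intro: legal_le_stabilizing)+

lemma route_eq: "settles \<sigma> \<rho> u \<Longrightarrow> route \<sigma> \<rho> = turn \<rho> u"
  unfolding route_def using settles_unique by (metis the_equality)

text \<open>The odometer in which every rotor x makes \<open>N * kappa x\<close> full turns.\<close>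

definition burn :: "nat \<Rightarrow> 'v \<Rightarrow> nat" where
  "burn N x = (if x \<in> V then N * kappa x * length (rot x) else 0)"

text \<open>The Laplacian of kappa: what each vertex loses in total if every rotor x makes kappa x full
  turns.\<close>

definition burn_chips :: "'v \<Rightarrow> nat" where
  "burn_chips x = kappa x * length (rot x) - (\<Sum>e\<in>incident_edges M x. kappa (dest x e))"

lemma burn_chips_pos: "x \<in> V \<Longrightarrow> 0 < burn_chips x"
  using superharmonic[of x] by (simp add: V_def burn_chips_def)

lemma turn_burn:
  assumes "\<rho> \<in> rotors"
  shows "turn \<rho> (burn N) = \<rho>"
proof
  fix x show "turn \<rho> (burn N) x = \<rho> x"
    using next_in_full_turn[of "rot x" "\<rho> x" "N * kappa x"] rotor_in_rot[OF assms] distinct_rot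
    by (auto simp: turn_def burn_def V_def)
qed

text \<open>In a full turn x sends one chip along each of its edges. Since an edge that leads from x to y
  also leads from y to x, the chips arriving at y can be summed over the edges at y.\<close>

lemma inflow_burn:
  assumes "\<rho> \<in> rotors" "y \<in> V"
  shows "inflow \<rho> (burn N) y = N * (\<Sum>e\<in>incident_edges M y. kappa (dest y e))"
proof -
  let ?I = "incident_edges M"
  have fin: "finite (?I x)" if "x \<in> V" for x
    using that set_rot[of x] by (metis List.finite_set V_def)
  have rotI: "set (rot x) = ?I x" if "x \<in> V" for x using that set_rot by (simp add: V_def)
  have "inflow \<rho> (burn N) y =
      (\<Sum>x\<in>V. (N * kappa x) * (\<Sum>e\<in>?I x. of_bool (dest x e = y)))"
    unfolding inflow_def
  proof (rule sum.cong[OF refl])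
    fix x assume x: "x \<in> V"
    show "(\<Sum>k<burn N x. of_bool (dest x ((next_in (rot x) ^^ Suc k) (\<rho> x)) = y)) =
        N * kappa x * (\<Sum>e\<in>?I x. of_bool (dest x e = y))"
      using sum_full_turns[of "rot x" "\<rho> x" "\<lambda>e. of_bool (dest x e = y)" "N * kappa x"]
        rotor_in_rot[OF assms(1) x] x distinct_rot set_rot
      by (simp add: V_def burn_def del: sum_of_bool_eq)
  qed
  also have "\<dots> = N * (\<Sum>x\<in>V. \<Sum>e\<in>?I x. if dest x e = y then kappa x else 0)"
    by (simp add: sum_distrib_left mult.assoc) (intro sum.cong refl, auto)
  also have "(\<Sum>x\<in>V. \<Sum>e\<in>?I x. if dest x e = y then kappa x else 0) =
      (\<Sum>x\<in>V. \<Sum>e | e \<in> ?I x \<and> dest x e = y. kappa x)"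
    by (rule sum.cong[OF refl]) (rule sum.inter_filter[OF fin, symmetric])
  also have "\<dots> = (\<Sum>(x, e)\<in>(SIGMA x:V. {e \<in> ?I x. dest x e = y}). kappa x)"
    using fin finite_V by (intro sum.Sigma) auto
  also have "\<dots> = (\<Sum>e | e \<in> ?I y \<and> dest y e \<in> V. kappa (dest y e))"
  proof (rule sum.reindex_bij_witness[where i = "\<lambda>e. (dest y e, e)" and j = snd])
    \<comment> \<open>An edge leads from x to y exactly if it leads from y to x.\<close>
    have other_end_sym: "e \<in> ?I (dest x e) \<and> dest (dest x e) e = x"
      if "x \<in> V" "e \<in> ?I x" "dest x e \<in> V" for x e
    proof -
      obtain z where z: "z = dest x e" by blast
      have ex: "e \<in> set (rot x)" using that rotI by blast
      note m = dest_props(2,3)[OF that(1) ex, folded z]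
      then have e: "e \<in> ?I z" by (simp add: incident_edges_def)
      then have "e \<in> set (rot z)" using that(3) rotI z by blast
      then have "mends M e = {z, dest z e}" using that(3) z by (intro dest_props) auto
      then have "dest z e = x" using m(1) by (metis doubleton_eq_iff)
      then show ?thesis using e z by simp
    qed
    have swap: "e \<in> ?I y \<and> dest y e = x" if "x \<in> V" "e \<in> ?I x" "dest x e = y" for x e
      using other_end_sym[OF that(1,2)] that(3) assms(2) by simp
    have swap': "e \<in> ?I (dest y e) \<and> dest (dest y e) e = y" if "e \<in> ?I y" "dest y e \<in> V" for e
      using other_end_sym[OF assms(2) that] .
    show "\<And>a. a \<in> (SIGMA x:V. {e \<in> ?I x. dest x e = y}) \<Longrightarrow> (dest y (snd a), snd a) = a"
      using swap by auto
    show "\<And>a. a \<in> (SIGMA x:V. {e \<in> ?I x. dest x e = y}) \<Longrightarrow> snd a \<in> {e. e \<in> ?I y \<and> dest y e \<in> V}"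
      using swap by auto
    show "\<And>b. b \<in> {e. e \<in> ?I y \<and> dest y e \<in> V} \<Longrightarrow>
        (dest y b, b) \<in> (SIGMA x:V. {e \<in> ?I x. dest x e = y})"
      using swap' by auto
    show "\<And>a. a \<in> (SIGMA x:V. {e \<in> ?I x. dest x e = y}) \<Longrightarrow> kappa (dest y (snd a)) = (case a of (x, e) \<Rightarrow> kappa x)"
      using swap by auto
  qed auto
  also have "\<dots> = (\<Sum>e\<in>?I y. kappa (dest y e))"
  proof (rule sum.mono_neutral_left)
    show "\<forall>e\<in>?I y - {e. e \<in> ?I y \<and> dest y e \<in> V}. kappa (dest y e) = 0"
      using dest_props(1)[OF assms(2)] rotI[OF assms(2)] kappa_sink by (auto simp: V_def)
  qed (use fin assms(2) in auto)
  finally show ?thesis .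
qed

lemma chips_burn:
  assumes "\<rho> \<in> rotors" "y \<in> V"
  shows "chips \<sigma> \<rho> (burn N) y = int (\<sigma> y) - int (N * burn_chips y)"
proof -
  have "(\<Sum>e\<in>incident_edges M y. kappa (dest y e)) \<le> kappa y * length (rot y)"
    using superharmonic[of y] assms(2) by (simp add: V_def)
  then have "int (N * burn_chips y) = int (burn N y) - int (inflow \<rho> (burn N) y)"
    using assms by (simp add: burn_def burn_chips_def inflow_burn of_nat_diff right_diff_distrib)
  then show ?thesis by (simp add: chips_def)
qed

lemma ex_burn_stabilizing:
  obtains N where "\<And>\<rho> x. \<rho> \<in> rotors \<Longrightarrow> x \<in> V \<Longrightarrow> chips \<sigma> \<rho> (burn N) x \<le> 0"
proof
  fix \<rho> x assume *: "\<rho> \<in> rotors" "x \<in> V"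
  let ?N = "sum \<sigma> V"
  have "\<sigma> x \<le> ?N" using * finite_V by (simp add: member_le_sum)
  also have "\<dots> \<le> ?N * burn_chips x" using burn_chips_pos[OF *(2)] by simp
  finally have "int (\<sigma> x) \<le> int (?N * burn_chips x)" by (rule of_nat_mono)
  then show "chips \<sigma> \<rho> (burn ?N) x \<le> 0" using chips_burn[OF *] by simp
qed

text \<open>By the least action principle all legal odometers lie below one stabilizing odometer, so a legal
  odometer of maximal total exists, and no vertex can fire after it.\<close>

lemma ex_settles:
  assumes "\<rho> \<in> rotors"
  shows "\<exists>u. settles \<sigma> \<rho> u"
proof -
  obtain N where N: "\<And>x. x \<in> V \<Longrightarrow> chips \<sigma> \<rho> (burn N) x \<le> 0"
    using ex_burn_stabilizing assms by metis
  have bound: "sum v V \<le> sum (burn N) V" if "legal \<sigma> \<rho> v" for v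
    using legal_le_stabilizing[OF that N] by (simp add: sum_mono)
  have "\<exists>v. legal \<sigma> \<rho> v \<and> (\<forall>v'. legal \<sigma> \<rho> v' \<longrightarrow> sum v' V \<le> sum v V)"
    by (rule ex_has_greatest_nat[of "legal \<sigma> \<rho>" "\<lambda>_. 0" "\<lambda>v. sum v V" "Suc (sum (burn N) V)"])
      (use legal_0 bound in \<open>auto simp: less_Suc_eq_le\<close>)
  then obtain v where v: "legal \<sigma> \<rho> v" "\<And>v'. legal \<sigma> \<rho> v' \<Longrightarrow> sum v' V \<le> sum v V" by blast
  have "chips \<sigma> \<rho> v x \<le> 0" if x: "x \<in> V" for x
  proof (rule ccontr)
    assume "\<not> chips \<sigma> \<rho> v x \<le> 0"
    then have "legal \<sigma> \<rho> (v(x := Suc (v x)))" using v(1) x by (intro legal_fire) auto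
    then have "sum (v(x := Suc (v x))) V \<le> sum v V" by (rule v(2))
    moreover have "sum v V < sum (v(x := Suc (v x))) V"
      using x finite_V by (intro sum_strict_mono_ex1) auto
    ultimately show False by simp
  qed
  then show ?thesis using v(1) by (auto simp: settles_def)
qed

lemma turn_in_rotors:
  assumes "\<rho> \<in> rotors" "legal \<sigma> \<rho> u"
  shows "turn \<rho> u \<in> rotors"
proof -
  have "turn \<rho> u x \<in> incident_edges M x" if "x \<in> V" for x
    using next_in_funpow_in_set[of "rot x" "\<rho> x" "u x"] rotor_in_rot[OF assms(1) that]
      that distinct_rot set_rot by (simp add: turn_def V_def)
  moreover have "turn \<rho> u x = undefined" if "x \<notin> V" for x
    using assms that legal_outside[OF assms(2) that]
    by (auto simp: turn_def rotor_configs_def V_def PiE_def extensional_def)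
  ultimately show ?thesis by (auto simp: rotor_configs_def V_def PiE_def extensional_def)
qed

lemma route_in_rotors: "\<rho> \<in> rotors \<Longrightarrow> route \<sigma> \<rho> \<in> rotors"
  using ex_settles[of \<rho> \<sigma>] turn_in_rotors route_eq by (auto simp: settles_def)

lemma legal_mono: "legal \<sigma> \<rho> u \<Longrightarrow> legal (\<lambda>x. \<sigma> x + \<tau> x) \<rho> u"
proof (induction rule: legal.induct)
  case (legal_fire u x)
  then show ?case by (intro legal.legal_fire) (auto simp: chips_add_initial)
qed (rule legal.legal_0)

lemma legal_continue:
  assumes "legal \<sigma> \<rho> u" "\<And>x. x \<in> V \<Longrightarrow> chips \<sigma> \<rho> u x = int (\<tau> x)"
    and "legal \<tau> (turn \<rho> u) v"
  shows "legal \<sigma> \<rho> (\<lambda>x. u x + v x)"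
  using assms(3)
proof (induction rule: legal.induct)
  case legal_0
  then show ?case using assms(1) by simp
next
  case (legal_fire v x)
  have "legal \<sigma> \<rho> ((\<lambda>x. u x + v x)(x := Suc (u x + v x)))"
    using legal_fire chips_add[of \<sigma> \<rho> u \<tau> x v] assms(2) by (intro legal.legal_fire) auto
  moreover have "(\<lambda>x. u x + v x)(x := Suc (u x + v x)) = (\<lambda>y. u y + (v(x := Suc (v x))) y)"
    by auto
  ultimately show ?case by simp
qed

text \<open>Legal firings can be carried out in advance without changing the result.\<close>

lemma route_continue:
  assumes "\<rho> \<in> rotors" "legal \<sigma> \<rho> u" "\<And>x. x \<in> V \<Longrightarrow> chips \<sigma> \<rho> u x = int (\<tau> x)"
  shows "route \<sigma> \<rho> = route \<tau> (turn \<rho> u)"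
proof -
  obtain v where v: "settles \<tau> (turn \<rho> u) v"
    using ex_settles turn_in_rotors assms(1,2) by blast
  then have "settles \<sigma> \<rho> (\<lambda>x. u x + v x)"
    using legal_continue[OF assms(2,3)] chips_add[OF assms(3)] by (auto simp: settles_def)
  then show ?thesis using v by (simp add: route_eq turn_add)
qed

lemma route_add:
  assumes "\<rho> \<in> rotors"
  shows "route (\<lambda>x. \<sigma> x + \<tau> x) \<rho> = route \<tau> (route \<sigma> \<rho>)"
proof -
  obtain u where u: "settles \<sigma> \<rho> u" using ex_settles assms by blast
  then have "route (\<lambda>x. \<sigma> x + \<tau> x) \<rho> = route \<tau> (turn \<rho> u)"
    using assms by (intro route_continue legal_mono)
      (auto simp: settles_def settles_chips[OF u] chips_add_initial)
  then show ?thesis using u by (simp add: route_eq)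
qed

lemma route_commute:
  assumes "\<rho> \<in> rotors"
  shows "route \<tau> (route \<sigma> \<rho>) = route \<sigma> (route \<tau> \<rho>)"
  using route_add[OF assms, of \<sigma> \<tau>] route_add[OF assms, of \<tau> \<sigma>] by (simp add: add.commute)

lemma route_0: "\<rho> \<in> rotors \<Longrightarrow> route (\<lambda>_. 0) \<rho> = \<rho>"
  using route_eq[of "\<lambda>_. 0" \<rho> "\<lambda>_. 0"] by (simp add: settles_def legal_0)

lemma route_cong:
  assumes "\<rho> \<in> rotors" "\<And>x. x \<in> V \<Longrightarrow> \<sigma> x = \<tau> x"
  shows "route \<sigma> \<rho> = route \<tau> \<rho>"
  using route_continue[OF assms(1) legal_0, of \<sigma> \<tau>] assms(2) by simp

section \<open>Acyclic rotor configurations\<close>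

abbreviation "recurrent \<equiv> recurrent_configs M s"

definition trap :: "('v \<Rightarrow> 'e) \<Rightarrow> 'v set \<Rightarrow> bool" where
  "trap \<rho> C \<longleftrightarrow> C \<subseteq> V \<and> C \<noteq> {} \<and> (\<forall>x\<in>C. dest x (\<rho> x) \<in> C)"

lemma recurrent_iff: "\<rho> \<in> recurrent \<longleftrightarrow> \<rho> \<in> rotors \<and> (\<forall>C. \<not> trap \<rho> C)"
  using acyclic_graph_iff_no_trap[OF finite_V, of "\<lambda>x. dest x (\<rho> x)"]
  unfolding recurrent_configs_def trap_def V_def by auto

lemma recurrent_in_rotors: "\<rho> \<in> recurrent \<Longrightarrow> \<rho> \<in> rotors"
  by (simp add: recurrent_iff)

text \<open>If x in C fires, its chip moves along the new rotor of x and hence stays in C; it only leaves C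
  when some vertex of C fires again. So a closed set in which something has fired is never
  empty of chips.\<close>

lemma chips_in_fired_trap:
  assumes "legal \<sigma> \<rho> u" "trap (turn \<rho> u) C" "\<exists>x\<in>C. 0 < u x"
  shows "\<exists>y\<in>C. 0 < chips \<sigma> \<rho> u y"
  using assms
proof (induction rule: legal.induct)
  case (legal_fire u x)
  let ?u = "u(x := Suc (u x))"
  let ?y = "dest x (next_in (rot x) (turn \<rho> u x))"
  note chips' = chips_Suc[OF legal_fire.hyps(2), of \<sigma> \<rho> u]
  note trap = legal_fire.prems(1)[unfolded turn_Suc]
  show ?case
  proof (cases "x \<in> C")
    case True
    then have "?y \<in> C" using trap by (auto simp: trap_def)
    moreover have "0 < chips \<sigma> \<rho> ?u ?y"
      unfolding chips' using legal_fire.hyps(3) legal_chips_nonneg[OF legal_fire.hyps(1), of ?y]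
      by (auto split: split_of_bool)
    ultimately show ?thesis by blast
  next
    case False
    then have "trap (turn \<rho> u) C" using trap unfolding trap_def by (metis fun_upd_other)
    moreover have "\<exists>z\<in>C. 0 < u z" using legal_fire.prems(2) False by (metis fun_upd_other)
    ultimately obtain y where y: "y \<in> C" "0 < chips \<sigma> \<rho> u y" using legal_fire.IH by blast
    then have "0 < chips \<sigma> \<rho> ?u y" unfolding chips' using False by (auto split: split_of_bool)
    then show ?thesis using y by blast
  qed
qed simp

lemma fired_trap_impossible:
  assumes "settles \<sigma> \<rho> u" "trap (turn \<rho> u) C" "x \<in> C"
  shows "u x = 0"
proof (rule ccontr)
  assume "u x \<noteq> 0"
  then obtain y where y: "y \<in> C" "0 < chips \<sigma> \<rho> u y"
    using assms chips_in_fired_trap[of \<sigma> \<rho> u C] by (auto simp: settles_def)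
  moreover have "y \<in> V" using y(1) assms(2) by (auto simp: trap_def)
  ultimately show False using assms(1) by (force simp: settles_def)
qed

lemma route_recurrent:
  assumes "\<rho> \<in> recurrent"
  shows "route \<sigma> \<rho> \<in> recurrent"
proof -
  obtain u where u: "settles \<sigma> \<rho> u"
    using ex_settles recurrent_in_rotors[OF assms] by blast
  have "\<not> trap (turn \<rho> u) C" for C
  proof
    assume C: "trap (turn \<rho> u) C"
    have "turn \<rho> u x = \<rho> x" if "x \<in> C" for x
      using fired_trap_impossible[OF u C that] by (simp add: turn_def)
    then have "trap \<rho> C" using C by (simp add: trap_def)
    then show False using assms by (simp add: recurrent_iff)
  qed
  then show ?thesis
    using route_in_rotors[OF recurrent_in_rotors[OF assms], of \<sigma>] u
    by (simp add: recurrent_iff route_eq)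
qed

text \<open>After one chip has been placed on each vertex, every vertex fires, and then every trap
  contains a vertex that has fired.\<close>

lemma recurrent_nonempty: "recurrent \<noteq> {}"
proof -
  have "(\<lambda>x\<in>V. hd (rot x)) \<in> rotors"
    using rot_nonempty set_rot by (force simp: rotor_configs_def V_def)
  then obtain \<rho> where \<rho>: "\<rho> \<in> rotors" by blast
  obtain u where u: "settles (\<lambda>_. 1) \<rho> u" using ex_settles[OF \<rho>] by blast
  have "0 < u x" if "x \<in> V" for x
    using settles_chips[OF u that] by (simp add: chips_def)
  then have "\<not> trap (turn \<rho> u) C" for C
    using fired_trap_impossible[OF u, of C] unfolding trap_def by (metis ex_in_conv less_irrefl subsetD)
  then have "turn \<rho> u \<in> recurrent"
    using u turn_in_rotors[OF \<rho>, of "\<lambda>_. 1" u] by (simp add: recurrent_iff settles_def)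
  then show ?thesis by blast
qed

text \<open>The odometer \<open>burn N\<close> leaves no chips, so the legal odometer u lies below it. Let C be the set
  of vertices where u is strictly smaller. The remaining firings, all in C, start and end
  without chips, so none of them can send a chip out of C. But the last firing of x in C goes
  along the rotor \<open>\<rho> x\<close>, because x has then made full turns, and acyclicity
  provides an x whose rotor leads out of C.\<close>

lemma route_burn:
  assumes "\<rho> \<in> recurrent"
  shows "route (\<lambda>x. N * burn_chips x) \<rho> = \<rho>"
proof -
  let ?\<sigma> = "\<lambda>x. N * burn_chips x" and ?w = "burn N"
  note \<rho> = recurrent_in_rotors[OF assms]
  have w0: "chips ?\<sigma> \<rho> ?w x = 0" if "x \<in> V" for x
    using chips_burn[OF \<rho> that, of ?\<sigma> N] by simp
  obtain u where u: "settles ?\<sigma> \<rho> u" using ex_settles \<rho> by blast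
  then have u0: "\<And>x. x \<in> V \<Longrightarrow> chips ?\<sigma> \<rho> u x = int 0" using settles_chips by simp
  have le: "u x \<le> ?w x" for x
    using u w0 by (intro legal_le_stabilizing[of ?\<sigma> \<rho>]) (auto simp: settles_def)
  \<comment> \<open>The firings that are missing from u.\<close>
  define v where "v x = ?w x - u x" for x
  have uv: "(\<lambda>x. u x + v x) = ?w" using le by (auto simp: v_def)
  define C where "C = {x \<in> V. 0 < v x}"
  have "C = {}"
  proof (rule ccontr)
    assume "C \<noteq> {}"
    moreover have "C \<subseteq> V" by (auto simp: C_def)
    ultimately obtain x where x: "x \<in> C" "dest x (\<rho> x) \<notin> C"
      using assms by (auto simp: recurrent_iff trap_def)
    let ?to = "\<lambda>z k. dest z ((next_in (rot z) ^^ Suc k) (turn \<rho> u z))"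
    have finC: "finite C" using finite_V by (simp add: C_def)
    have inflow: "inflow (turn \<rho> u) v y = v y" if "y \<in> C" for y
    proof -
      have "chips (\<lambda>_. 0) (turn \<rho> u) v y = 0"
        using chips_add[of ?\<sigma> \<rho> u "\<lambda>_. 0" y v] u0 w0[of y] that uv by (simp add: C_def)
      then show ?thesis by (simp add: chips_def)
    qed
    have "(\<Sum>y\<in>C. inflow (turn \<rho> u) v y) = (\<Sum>y\<in>C. \<Sum>z\<in>C. \<Sum>k<v z. of_bool (?to z k = y))"
      unfolding inflow_def using finite_V
      by (intro sum.cong refl sum.mono_neutral_right) (auto simp: C_def)
    also have "\<dots> = (\<Sum>z\<in>C. \<Sum>y\<in>C. \<Sum>k<v z. of_bool (?to z k = y))"
      by (rule sum.swap)
    also have "\<dots> = (\<Sum>z\<in>C. \<Sum>k<v z. \<Sum>y\<in>C. of_bool (?to z k = y))"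
      by (intro sum.cong refl sum.swap)
    also have "\<dots> = (\<Sum>z\<in>C. \<Sum>k<v z. of_bool (?to z k \<in> C))"
      using finC by (intro sum.cong refl) (simp add: of_bool_def)
    also have "\<dots> < (\<Sum>z\<in>C. v z)"
    proof (rule sum_strict_mono_ex1[OF finC])
      have le1: "(\<Sum>k<v z. of_bool (?to z k \<in> C)) \<le> (\<Sum>k<v z. 1::nat)" for z
        by (intro sum_mono) simp
      then show "\<forall>z\<in>C. (\<Sum>k<v z. of_bool (?to z k \<in> C)) \<le> v z" by simp
      have "0 < v x" using x by (simp add: C_def)
      then obtain k where k: "v x = Suc k" by (cases "v x") auto
      \<comment> \<open>The rotor of x after its last missing firing is its initial rotor.\<close>
      have "(next_in (rot x) ^^ Suc k) (turn \<rho> u x) = turn \<rho> ?w x"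
        unfolding uv[symmetric] turn_add by (simp only: turn_def k)
      also have "\<dots> = \<rho> x" by (simp add: turn_burn[OF \<rho>])
      finally have "?to x k \<notin> C" using x by simp
      then have "(\<Sum>k<v x. of_bool (?to x k \<in> C)) < (\<Sum>k<v x. 1::nat)"
        by (intro sum_strict_mono_ex1) (auto simp: k intro!: bexI[of _ k])
      then show "\<exists>z\<in>C. (\<Sum>k<v z. of_bool (?to z k \<in> C)) < v z"
        using x(1) by auto
    qed
    finally show False using inflow by simp
  qed
  have "u = ?w"
  proof
    fix x show "u x = ?w x"
      using \<open>C = {}\<close> le[of x] by (cases "x \<in> V") (auto simp: C_def v_def burn_def)
  qed
  then show ?thesis using u turn_burn[OF \<rho>] by (simp add: route_eq)
qed

text \<open>The chips \<open>\<sigma>\<close> can be completed to a multiple of \<open>burn_chips\<close>, which is positive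
  everywhere and acts as the identity.\<close>

lemma ex_route_inverse:
  obtains \<tau> where "\<And>\<rho>. \<rho> \<in> recurrent \<Longrightarrow> route \<tau> (route \<sigma> \<rho>) = \<rho>"
proof
  let ?N = "sum \<sigma> V"
  fix \<rho> assume \<rho>: "\<rho> \<in> recurrent"
  have le: "\<sigma> x \<le> ?N * burn_chips x" if "x \<in> V" for x
  proof -
    have "\<sigma> x \<le> ?N" using that finite_V by (simp add: member_le_sum)
    also have "\<dots> \<le> ?N * burn_chips x" using burn_chips_pos[OF that] by simp
    finally show ?thesis .
  qed
  have "route (\<lambda>x. ?N * burn_chips x - \<sigma> x) (route \<sigma> \<rho>) =
      route (\<lambda>x. \<sigma> x + (?N * burn_chips x - \<sigma> x)) \<rho>"
    by (rule route_add[OF recurrent_in_rotors[OF \<rho>], symmetric])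
  also have "\<dots> = route (\<lambda>x. ?N * burn_chips x) \<rho>"
    using le by (intro route_cong recurrent_in_rotors \<rho>) simp
  also have "\<dots> = \<rho>" by (rule route_burn[OF \<rho>])
  finally show "route (\<lambda>x. ?N * burn_chips x - \<sigma> x) (route \<sigma> \<rho>) = \<rho>" .
qed

text \<open>Let \<open>\<alpha> x\<close> be the number of turns that take the rotor \<open>\<rho> x\<close> to \<open>\<rho>' x\<close>. With
  \<open>\<alpha> x\<close> chips at each x these firings are legal, and they leave the rotors
  \<open>\<rho>'\<close> with some chips still to be routed; the effect of those chips can be inverted.\<close>

lemma route_transitive:
  assumes "\<rho> \<in> recurrent" "\<rho>' \<in> recurrent"
  obtains \<sigma> where "route \<sigma> \<rho> = \<rho>'"
proof -
  note r = recurrent_in_rotors[OF assms(1)] recurrent_in_rotors[OF assms(2)]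
  have "\<exists>n. (next_in (rot x) ^^ n) (\<rho> x) = \<rho>' x" if "x \<in> V" for x
    using that r rotor_in_rot distinct_rot[folded V_def] next_in_reaches by metis
  then obtain a where a: "\<And>x. x \<in> V \<Longrightarrow> (next_in (rot x) ^^ a x) (\<rho> x) = \<rho>' x" by metis
  define \<alpha> where "\<alpha> x = (if x \<in> V then a x else 0)" for x
  have turn_\<alpha>: "turn \<rho> \<alpha> = \<rho>'"
  proof
    fix x show "turn \<rho> \<alpha> x = \<rho>' x"
      using a[of x] r by (auto simp: turn_def \<alpha>_def rotor_configs_def V_def PiE_def extensional_def)
  qed
  have "legal \<alpha> \<rho> u" if "sum u V = n" "\<And>x. u x \<le> \<alpha> x" for u n
    using that
  proof (induction n arbitrary: u)
    case 0
    have "u = (\<lambda>_. 0)"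
    proof
      fix x show "u x = 0"
        using 0(1) 0(2)[of x] finite_V by (cases "x \<in> V") (auto simp: \<alpha>_def)
    qed
    then show ?case by (simp add: legal_0)
  next
    case (Suc n)
    have "\<exists>x\<in>V. u x \<noteq> 0" using Suc.prems(1) by (metis nat.distinct(1) sum.neutral)
    then obtain x m where x: "x \<in> V" "u x = Suc m" by (metis not0_implies_Suc)
    let ?u = "u(x := m)"
    have "sum u V = u x + sum u (V - {x})" using x finite_V by (simp add: sum.remove)
    moreover have "sum ?u V = m + sum u (V - {x})"
      using x finite_V by (simp add: sum.remove)
    moreover have "?u z \<le> \<alpha> z" for z
      using Suc.prems(2)[of z] x by auto
    ultimately have "legal \<alpha> \<rho> ?u"
      using Suc.prems(1) x by (intro Suc.IH) auto
    moreover have "m < \<alpha> x" using Suc.prems(2)[of x] x by simp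
    ultimately have "legal \<alpha> \<rho> (?u(x := Suc (?u x)))"
      using x by (intro legal_fire) (auto simp: chips_def)
    moreover have "?u(x := Suc (?u x)) = u" using x by auto
    ultimately show ?case by simp
  qed
  then have \<alpha>: "legal \<alpha> \<rho> \<alpha>" by blast
  have 1: "route \<alpha> \<rho> = route (inflow \<rho> \<alpha>) \<rho>'"
    using route_continue[OF r(1) \<alpha>, of "inflow \<rho> \<alpha>"] by (simp add: turn_\<alpha> chips_def)
  obtain \<tau> where "route \<tau> (route (inflow \<rho> \<alpha>) \<rho>') = \<rho>'"
    using ex_route_inverse assms(2) by metis
  then have "route (\<lambda>x. \<alpha> x + \<tau> x) \<rho> = \<rho>'" by (simp add: route_add[OF r(1)] 1)
  then show thesis by (rule that)
qed

section \<open>The order of the rotor-router group\<close>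

text \<open>A walk is the process with one chip, in which the only vertex that can fire is the position of
  the walker.\<close>

lemma rr_walk:
  assumes "\<rho> \<in> rotors" "x \<in> V" "\<And>m. m < n \<Longrightarrow> fst ((rr_step M rot ^^ m) (x, \<rho>)) \<noteq> s"
  shows "\<exists>u. legal (\<lambda>y. of_bool (y = x)) \<rho> u \<and> sum u V = n \<and>
    fst ((rr_step M rot ^^ n) (x, \<rho>)) \<in> mverts M \<and>
    snd ((rr_step M rot ^^ n) (x, \<rho>)) = turn \<rho> u \<and>
    (\<forall>y\<in>V. chips (\<lambda>y. of_bool (y = x)) \<rho> u y = of_bool (y = fst ((rr_step M rot ^^ n) (x, \<rho>))))"
  using assms(3)
proof (induction n)
  case 0
  then show ?case
    using assms(2) by (intro exI[of _ "\<lambda>_. 0"]) (auto simp: legal_0 V_def)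
next
  case (Suc n)
  let ?\<sigma> = "\<lambda>y. of_bool (y = x)"
  obtain z \<rho>' where z: "(rr_step M rot ^^ n) (x, \<rho>) = (z, \<rho>')" by fastforce
  obtain u where u: "legal ?\<sigma> \<rho> u" "sum u V = n" "z \<in> mverts M" "\<rho>' = turn \<rho> u"
      "\<And>y. y \<in> V \<Longrightarrow> chips ?\<sigma> \<rho> u y = of_bool (y = z)"
    using Suc z by (metis fst_conv less_Suc_eq snd_conv)
  have zV: "z \<in> V" using Suc.prems[of n] u(3) z by (simp add: V_def)
  let ?e = "next_in (rot z) (\<rho>' z)"
  have step: "(rr_step M rot ^^ Suc n) (x, \<rho>) = (dest z ?e, \<rho>'(z := ?e))"
    using z by (simp add: rr_step_def Let_def)
  have rho': "\<rho>' z \<in> set (rot z)" using turn_in_rotors[OF assms(1) u(1)] rotor_in_rot zV u(4) by simp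
  have "?e \<in> set (rot z)"
    using next_in_funpow_in_set[OF _ rho', of 1] distinct_rot zV by (simp add: V_def)
  then have "dest z ?e \<in> mverts M" by (rule dest_props(1)[OF zV])
  moreover have "legal ?\<sigma> \<rho> (u(z := Suc (u z)))"
    using u zV by (intro legal_fire) auto
  moreover have "sum (u(z := Suc (u z))) V = Suc n"
    using u(2) zV finite_V by (simp add: sum.remove)
  moreover have "\<rho>'(z := ?e) = turn \<rho> (u(z := Suc (u z)))"
    unfolding turn_Suc u(4) ..
  moreover have "chips ?\<sigma> \<rho> (u(z := Suc (u z))) y = of_bool (y = dest z ?e)" if "y \<in> V" for y
    unfolding chips_Suc[OF zV] using u(5)[OF that] u(4) by auto
  ultimately show ?case unfolding step fst_conv snd_conv by blast
qed

lemma rr_op_eq_route: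
  assumes "\<rho> \<in> rotors" "x \<in> V"
  shows "rr_op M rot s x \<rho> = route (\<lambda>y. of_bool (y = x)) \<rho>"
proof -
  let ?\<sigma> = "\<lambda>y. of_bool (y = x)"
  let ?at = "\<lambda>n. fst ((rr_step M rot ^^ n) (x, \<rho>))"
  obtain N where N: "\<And>y. y \<in> V \<Longrightarrow> chips ?\<sigma> \<rho> (burn N) y \<le> 0"
    using ex_burn_stabilizing assms(1) by metis
  have "\<exists>n. ?at n = s"
  proof (rule ccontr)
    assume "\<nexists>n. ?at n = s"
    then obtain u where u: "legal ?\<sigma> \<rho> u" "sum u V = Suc (sum (burn N) V)"
      using rr_walk[OF assms, of "Suc (sum (burn N) V)"] by blast
    have "sum u V \<le> sum (burn N) V" using legal_le_stabilizing[OF u(1) N] by (simp add: sum_mono)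
    then show False using u(2) by simp
  qed
  then have at: "?at (LEAST n. ?at n = s) = s" by (rule LeastI_ex)
  obtain u where u: "legal ?\<sigma> \<rho> u"
      "snd ((rr_step M rot ^^ (LEAST n. ?at n = s)) (x, \<rho>)) = turn \<rho> u"
      "\<And>y. y \<in> V \<Longrightarrow> chips ?\<sigma> \<rho> u y = of_bool (y = ?at (LEAST n. ?at n = s))"
    using rr_walk[OF assms, of "LEAST n. ?at n = s"] not_less_Least by blast
  have "settles ?\<sigma> \<rho> u" using u(1,3) at by (auto simp: settles_def V_def)
  then show ?thesis using u(2) by (simp add: route_eq rr_op_def Let_def)
qed

definition act :: "('v \<Rightarrow> nat) \<Rightarrow> ('v \<Rightarrow> 'e) \<Rightarrow> 'v \<Rightarrow> 'e" where
  "act \<sigma> = restrict (route \<sigma>) recurrent"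

lemma act_in_Bij: "act \<sigma> \<in> Bij recurrent"
proof -
  obtain \<tau> where \<tau>: "\<And>\<rho>. \<rho> \<in> recurrent \<Longrightarrow> route \<tau> (route \<sigma> \<rho>) = \<rho>"
    using ex_route_inverse by blast
  have "bij_betw (act \<sigma>) recurrent recurrent"
    by (rule bij_betw_byWitness[where f' = "route \<tau>"])
      (use \<tau> route_recurrent route_commute[OF recurrent_in_rotors] in \<open>auto simp: act_def\<close>)
  then show ?thesis by (simp add: Bij_def act_def)
qed

lemma act_add: "act (\<lambda>x. \<sigma> x + \<tau> x) = act \<tau> \<otimes>\<^bsub>BijGroup recurrent\<^esub> act \<sigma>"
  using act_in_Bij
  by (auto simp: BijGroup_def compose_def act_def route_recurrent route_add[OF recurrent_in_rotors])

lemma act_0: "act (\<lambda>_. 0) = \<one>\<^bsub>BijGroup recurrent\<^esub>"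
  by (auto simp: BijGroup_def act_def route_0[OF recurrent_in_rotors])

lemma act_cong: "(\<And>x. x \<in> V \<Longrightarrow> \<sigma> x = \<tau> x) \<Longrightarrow> act \<sigma> = act \<tau>"
  unfolding act_def by (intro restrict_ext route_cong recurrent_in_rotors)

text \<open>Inverses of generators are again of the form \<open>act \<tau>\<close>, so no formal inverses are
  needed to describe the group.\<close>

lemma carrier_RR: "carrier (RR M rot s) = range act"
proof -
  interpret B: group "BijGroup recurrent" by (rule group_BijGroup)
  let ?\<delta> = "\<lambda>x y. of_bool (y = x) :: nat"
  let ?S = "{act (?\<delta> x) | x. x \<in> V}"
  have gens: "{restrict (rr_op M rot s x) recurrent | x. x \<in> mverts M - {s}} = ?S"
  proof -
    have "restrict (rr_op M rot s x) recurrent = act (?\<delta> x)" if "x \<in> V" for x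
      unfolding act_def using that by (intro restrict_ext rr_op_eq_route recurrent_in_rotors)
    then show ?thesis unfolding V_def[symmetric] by metis
  qed
  have S: "?S \<subseteq> carrier (BijGroup recurrent)"
    using act_in_Bij by (auto simp: BijGroup_def)
  have "g \<in> range act" if "g \<in> generate (BijGroup recurrent) ?S" for g
    using that
  proof (induction rule: generate.induct)
    case one
    then show ?case using act_0 by (metis rangeI)
  next
    case (incl g)
    then show ?case by auto
  next
    case (inv g)
    then obtain x where g: "g = act (?\<delta> x)" by blast
    obtain \<tau> where \<tau>: "\<And>\<rho>. \<rho> \<in> recurrent \<Longrightarrow> route \<tau> (route (?\<delta> x) \<rho>) = \<rho>"
      using ex_route_inverse by blast
    have "act \<tau> \<otimes>\<^bsub>BijGroup recurrent\<^esub> act (?\<delta> x) = \<one>\<^bsub>BijGroup recurrent\<^esub>"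
      unfolding act_add[symmetric] using \<tau>
      by (auto simp: BijGroup_def act_def route_add[OF recurrent_in_rotors])
    then have "inv\<^bsub>BijGroup recurrent\<^esub> g = act \<tau>"
      unfolding g using act_in_Bij by (intro B.inv_equality) (auto simp: BijGroup_def)
    then show ?case by blast
  next
    case (eng g h)
    then obtain \<sigma> \<tau> where "g = act \<sigma>" "h = act \<tau>" by blast
    then have "g \<otimes>\<^bsub>BijGroup recurrent\<^esub> h = act (\<lambda>x. \<tau> x + \<sigma> x)" by (simp only: act_add)
    then show ?case by blast
  qed
  moreover have "act \<sigma> \<in> generate (BijGroup recurrent) ?S" if "sum \<sigma> V = n" for \<sigma> n
    using that
  proof (induction n arbitrary: \<sigma>)
    case 0
    then have "act \<sigma> = act (\<lambda>_. 0)" using finite_V by (intro act_cong) simp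
    then show ?case by (simp add: act_0 generate.one)
  next
    case (Suc n)
    then obtain x where x: "x \<in> V" "0 < \<sigma> x" by (metis gr0I nat.distinct(1) sum.neutral)
    let ?\<sigma> = "\<lambda>y. \<sigma> y - ?\<delta> x y"
    have eq: "\<sigma> = (\<lambda>y. ?\<sigma> y + ?\<delta> x y)" using x by (auto split: split_of_bool)
    have "sum \<sigma> V = sum ?\<sigma> V + sum (?\<delta> x) V"
      by (subst eq) (simp only: sum.distrib)
    moreover have "sum (?\<delta> x) V = 1"
      using x finite_V by (simp add: of_bool_def)
    ultimately have "act ?\<sigma> \<in> generate (BijGroup recurrent) ?S" using Suc.prems by (intro Suc.IH) simp
    moreover have "act (?\<delta> x) \<in> generate (BijGroup recurrent) ?S"
      using x by (blast intro: generate.incl)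
    ultimately show ?case by (subst eq) (simp only: act_add generate.eng)
  qed
  ultimately have "generate (BijGroup recurrent) ?S = range act" by blast
  then show ?thesis
    unfolding RR_def carrier_subgroup_generated gens using S by (simp add: Int_absorb1)
qed

text \<open>A commutative transitive action is free: an operator is determined by its value at a single
  configuration.\<close>

theorem order_RR: "order (RR M rot s) = card recurrent"
proof -
  obtain \<rho>0 where \<rho>0: "\<rho>0 \<in> recurrent" using recurrent_nonempty by blast
  have "bij_betw (\<lambda>g. g \<rho>0) (range act) recurrent"
  proof (rule bij_betw_imageI)
    show "inj_on (\<lambda>g. g \<rho>0) (range act)"
    proof (rule inj_onI, clarify)
      fix \<sigma> \<tau> assume "act \<sigma> \<rho>0 = act \<tau> \<rho>0"
      then have eq: "route \<sigma> \<rho>0 = route \<tau> \<rho>0" using \<rho>0 by (simp add: act_def)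
      show "act \<sigma> = act \<tau>"
        unfolding act_def
      proof (rule restrict_ext)
        fix \<rho> assume "\<rho> \<in> recurrent"
        then obtain \<upsilon> where \<upsilon>: "\<rho> = route \<upsilon> \<rho>0" using route_transitive \<rho>0 by metis
        show "route \<sigma> \<rho> = route \<tau> \<rho>"
          unfolding \<upsilon> route_commute[OF recurrent_in_rotors[OF \<rho>0], of _ \<upsilon>] eq ..
      qed
    qed
    show "(\<lambda>g. g \<rho>0) ` range act = recurrent"
    proof
      show "(\<lambda>g. g \<rho>0) ` range act \<subseteq> recurrent"
        using \<rho>0 route_recurrent by (auto simp: act_def)
      show "recurrent \<subseteq> (\<lambda>g. g \<rho>0) ` range act"
      proof
        fix \<rho> assume "\<rho> \<in> recurrent"
        then obtain \<sigma> where "route \<sigma> \<rho>0 = \<rho>" using route_transitive \<rho>0 by metis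
        then have "act \<sigma> \<rho>0 = \<rho>" using \<rho>0 by (simp add: act_def)
        then show "\<rho> \<in> (\<lambda>g. g \<rho>0) ` range act" by blast
      qed
    qed
  qed
  then show ?thesis unfolding order_def carrier_RR by (rule bij_betw_same_card)
qed

end

section \<open>Directed covers and pointings\<close>

lemma snoc_in_tree_nodes:
  "x @ [c] \<in> tree_nodes G t \<longleftrightarrow> x \<in> tree_nodes G t \<and> c \<in> {1..out_degree G (t x)}"
proof
  assume "x @ [c] \<in> tree_nodes G t"
  then show "x \<in> tree_nodes G t \<and> c \<in> {1..out_degree G (t x)}"
    by (cases rule: tree_nodes.cases) auto
qed (auto intro: tree_nodes.child)

lemma finite_level: "finite {x \<in> tree_nodes G t. length x = n}"
proof (induction n)
  case (Suc n)
  have "{x \<in> tree_nodes G t. length x = Suc n} \<subseteq>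
      (\<Union>x\<in>{x \<in> tree_nodes G t. length x = n}. (\<lambda>c. x @ [c]) ` {1..out_degree G (t x)})"
  proof
    fix x assume "x \<in> {x \<in> tree_nodes G t. length x = Suc n}"
    then show "x \<in> (\<Union>x\<in>{x \<in> tree_nodes G t. length x = n}. (\<lambda>c. x @ [c]) ` {1..out_degree G (t x)})"
      by (cases x rule: rev_cases) (auto simp: snoc_in_tree_nodes)
  qed
  then show ?case by (rule finite_subset) (use Suc in auto)
qed auto

definition internal :: "('a, 'b) pre_digraph \<Rightarrow> (nat list \<Rightarrow> 'a) \<Rightarrow> nat \<Rightarrow> nat list set" where
  "internal G t h = {x \<in> tree_nodes G t. length x < h}"

lemma finite_internal: "finite (internal G t h)"
proof -
  have "internal G t h = (\<Union>n<h. {x \<in> tree_nodes G t. length x = n})"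
    by (auto simp: internal_def)
  then show ?thesis by (simp add: finite_level)
qed

definition choices :: "('a, 'b) pre_digraph \<Rightarrow> (nat list \<Rightarrow> 'a) \<Rightarrow> nat \<Rightarrow> (nat list \<Rightarrow> nat) set" where
  "choices G t h = (\<Pi>\<^sub>E x\<in>internal G t h. {0..out_degree G (t x)})"

text \<open>The choice 0 stands for the parent and \<open>c > 0\<close> for the child number c, as in
  \<^const>\<open>neighbour\<close>. A child of height h is a sink and makes no choice, so it imposes no
  condition.\<close>

definition pointings :: "('a, 'b) pre_digraph \<Rightarrow> (nat list \<Rightarrow> 'a) \<Rightarrow> nat \<Rightarrow> (nat list \<Rightarrow> nat) set" where
  "pointings G t h = {p \<in> choices G t h.
     \<forall>x c. x \<in> internal G t h \<longrightarrow> x @ [c] \<in> internal G t h \<longrightarrow> p x = c \<longrightarrow> p (x @ [c]) \<noteq> 0}"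

lemma finite_pointings: "finite (pointings G t h)"
  unfolding pointings_def choices_def using finite_internal
  by (intro finite_subset[OF Collect_subset] finite_PiE) auto

lemma card_pointings_split:
  "card (pointings G t h) = card {p \<in> pointings G t h. p [] = 0} + card {p \<in> pointings G t h. p [] \<noteq> 0}"
proof -
  have "pointings G t h = {p \<in> pointings G t h. p [] = 0} \<union> {p \<in> pointings G t h. p [] \<noteq> 0}"
    by blast
  then have "card (pointings G t h) =
      card ({p \<in> pointings G t h. p [] = 0} \<union> {p \<in> pointings G t h. p [] \<noteq> 0})"
    by (rule arg_cong)
  also have "\<dots> = card {p \<in> pointings G t h. p [] = 0} + card {p \<in> pointings G t h. p [] \<noteq> 0}"
  proof (rule card_Un_disjoint)
    show "{p \<in> pointings G t h. p [] = 0} \<inter> {p \<in> pointings G t h. p [] \<noteq> 0} = {}" by blast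
  qed (simp_all add: finite_pointings)
  finally show ?thesis .
qed

locale cover_tree =
  fixes G :: "('a, 'b) pre_digraph" and t :: "nat list \<Rightarrow> 'a" and h :: nat
  assumes h_pos: "0 < h"
begin

abbreviation "d x \<equiv> out_degree G (t x)"
abbreviation "I \<equiv> internal G t h"
abbreviation "Tr \<equiv> trunc_tree G t h"
abbreviation "S \<equiv> sinks G t h"
abbreviation "W \<equiv> wired_tree G t h"
abbreviation edge :: "nat list \<Rightarrow> nat \<Rightarrow> pvertex set" where "edge x c \<equiv> {Node x, neighbour x c}"

lemma mends_Tr [simp]: "mends Tr e = e"
  by (simp add: trunc_tree_def)

lemma root_in_I: "[] \<in> I"
  using h_pos by (simp add: internal_def tree_nodes.root)

lemma Node_notin_S: "x \<in> I \<Longrightarrow> Node x \<notin> S"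
  by (auto simp: internal_def sinks_def down_sink_def up_sink_def)

lemma verts_Tr: "mverts Tr = S \<union> Node ` I"
  by (auto simp: trunc_tree_def sinks_def down_sink_def up_sink_def internal_def trunc_nodes_def
      image_iff)

lemma S_subset: "S \<subseteq> mverts Tr"
  by (simp add: verts_Tr)

lemma verts_W: "mverts W - {None} = Some ` Node ` I"
proof -
  have "mverts Tr - S = Node ` I" using Node_notin_S by (auto simp: verts_Tr)
  then show ?thesis by (auto simp: wired_tree_def contract_def)
qed

lemma neighbour_neq: "neighbour x c \<noteq> Node x"
  by (cases c; cases x rule: rev_cases) auto

lemma neighbour_inj: "neighbour x c = neighbour x c' \<longleftrightarrow> c = c'"
proof -
  have "butlast x \<noteq> x @ [k]" for k by (cases x rule: rev_cases) auto
  then show ?thesis by (cases c; cases c') (auto dest: sym)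
qed

lemma edge_inj: "edge x c = edge x c' \<longleftrightarrow> c = c'"
  using neighbour_neq neighbour_inj by (auto simp: doubleton_eq_iff)

text \<open>The edge from x to its child is the edge from that child to its parent.\<close>

lemma edge_Suc: "edge x (Suc c) = edge (x @ [Suc c]) 0"
  by auto

lemma medges_Tr: "medges Tr = {edge y 0 | y. y \<in> trunc_nodes G t h}"
  by (simp add: trunc_tree_def)

lemma edges_at_Node:
  assumes "x \<in> I"
  shows "{e \<in> medges Tr. Node x \<in> e} = edge x ` {0..d x}"
proof
  show "{e \<in> medges Tr. Node x \<in> e} \<subseteq> edge x ` {0..d x}"
  proof
    fix e assume "e \<in> {e \<in> medges Tr. Node x \<in> e}"
    then obtain y where y: "e = edge y 0" "y \<in> trunc_nodes G t h" "Node x \<in> edge y 0"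
      by (auto simp: medges_Tr)
    show "e \<in> edge x ` {0..d x}"
    proof (cases "y = x")
      case True
      show ?thesis unfolding y(1) True by (rule imageI) simp
    next
      case False
      then have "y \<noteq> []" "butlast y = x" using y(3) by (auto split: if_splits)
      then obtain c where c: "y = x @ [c]" by (metis append_butlast_last_id)
      then have "c \<in> {1..d x}" using y(2) by (auto simp: trunc_nodes_def snoc_in_tree_nodes)
      then obtain k where k: "c = Suc k" "Suc k \<le> d x" by (cases c) auto
      have "e = edge x (Suc k)" by (simp only: y(1) c k(1) edge_Suc)
      moreover have "edge x (Suc k) \<in> edge x ` {0..d x}" by (rule imageI) (use k in simp)
      ultimately show ?thesis by simp
    qed
  qed
next
  show "edge x ` {0..d x} \<subseteq> {e \<in> medges Tr. Node x \<in> e}"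
  proof
    fix e assume "e \<in> edge x ` {0..d x}"
    then obtain c where c: "e = edge x c" "c \<le> d x" by auto
    have "\<exists>y\<in>trunc_nodes G t h. edge x c = edge y 0"
    proof (cases c)
      case 0
      have "x \<in> trunc_nodes G t h" using assms by (simp add: internal_def trunc_nodes_def)
      then show ?thesis unfolding 0 by blast
    next
      case (Suc k)
      then have "x @ [Suc k] \<in> trunc_nodes G t h"
        using assms c(2) by (simp add: internal_def trunc_nodes_def snoc_in_tree_nodes)
      then show ?thesis unfolding Suc edge_Suc by blast
    qed
    then have "e \<in> medges Tr" unfolding c(1) medges_Tr by blast
    then show "e \<in> {e \<in> medges Tr. Node x \<in> e}" using c(1) by simp
  qed
qed

lemma neighbour_in_verts:
  assumes "x \<in> I" "c \<le> d x"
  shows "neighbour x c \<in> mverts Tr"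
proof -
  have "neighbour x 0 \<in> mverts Tr"
    using assms(1) by (cases x rule: rev_cases)
      (auto simp: internal_def trunc_tree_def trunc_nodes_def snoc_in_tree_nodes)
  moreover have "neighbour x (Suc k) \<in> mverts Tr" if "c = Suc k" for k
    using assms that by (auto simp: internal_def trunc_tree_def trunc_nodes_def snoc_in_tree_nodes)
  ultimately show ?thesis by (cases c) auto
qed

lemma contract_vertex_Node: "x \<in> I \<Longrightarrow> contract_vertex S v = Some (Node x) \<longleftrightarrow> v = Node x"
  using Node_notin_S by (auto simp: contract_vertex_def)

lemma incident_W:
  assumes "x \<in> I"
  shows "incident_edges W (Some (Node x)) = edge x ` {0..d x}"
proof -
  have "incident_edges W (Some (Node x)) = {e \<in> medges Tr. Some (Node x) \<in> contract_vertex S ` e}"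
    by (auto simp: incident_edges_def wired_tree_def contract_def)
  also have "\<dots> = {e \<in> medges Tr. Node x \<in> e}"
    using contract_vertex_Node[OF assms] by (metis (no_types, lifting) image_iff)
  finally show ?thesis using edges_at_Node[OF assms] by simp
qed

lemma other_end_W:
  assumes "x \<in> I"
  shows "other_end W (edge x c) (Some (Node x)) = contract_vertex S (neighbour x c)"
proof -
  have "contract_vertex S (Node x) = Some (Node x)" using contract_vertex_Node[OF assms] by blast
  then have "mends W (edge x c) = {Some (Node x), contract_vertex S (neighbour x c)}"
    by (simp add: wired_tree_def contract_def)
  then show ?thesis by (rule other_end_eq)
qed

section \<open>A strictly superharmonic function on the wired tree\<close>

definition total_degree :: nat where
  "total_degree = (\<Sum>x\<in>I. d x)"

text \<open>The increments of this function decrease by a factor larger than every degree. Thus at a node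
  of height n the loss towards the parent outweighs the gains towards all children.\<close>

definition height_pot :: "nat \<Rightarrow> nat" where
  "height_pot n = (\<Sum>l\<le>n. Suc total_degree ^ (h - l))"

definition kappa :: "pvertex option \<Rightarrow> nat" where
  "kappa v = (case v of Some (Node x) \<Rightarrow> height_pot (length x) | _ \<Rightarrow> 0)"

lemma kappa_parent:
  assumes "x \<in> I"
  shows "kappa (contract_vertex S (neighbour x 0)) + Suc total_degree ^ (h - length x) \<le> height_pot (length x)"
proof (cases x rule: rev_cases)
  case Nil
  then show ?thesis by (simp add: contract_vertex_def kappa_def height_pot_def)
next
  case (snoc y c)
  then show ?thesis by (auto simp: contract_vertex_def kappa_def height_pot_def)
qed

lemma kappa_child:
  "kappa (contract_vertex S (neighbour x (Suc c))) \<le>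
    height_pot (length x) + Suc total_degree ^ (h - Suc (length x))"
  by (auto simp: contract_vertex_def kappa_def height_pot_def)

lemma kappa_superharmonic:
  assumes "x \<in> I"
  shows "(\<Sum>c\<le>d x. kappa (contract_vertex S (neighbour x c))) < height_pot (length x) * Suc (d x)"
proof -
  let ?l = "length x"
  let ?g = "Suc total_degree ^ (h - Suc ?l)"
  have g: "Suc total_degree ^ (h - ?l) = Suc total_degree * ?g"
    using assms by (auto simp: internal_def Suc_diff_Suc simp flip: power_Suc)
  have "d x \<le> total_degree" unfolding total_degree_def using assms finite_internal by (intro member_le_sum) auto
  then have "d x * ?g < Suc total_degree * ?g" by (intro mult_strict_right_mono) auto
  moreover have "(\<Sum>c\<le>d x. kappa (contract_vertex S (neighbour x c))) =
      kappa (contract_vertex S (neighbour x 0)) +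
      (\<Sum>c<d x. kappa (contract_vertex S (neighbour x (Suc c))))"
    by (rule sum.atMost_shift)
  moreover have "(\<Sum>c<d x. kappa (contract_vertex S (neighbour x (Suc c)))) \<le>
      d x * (height_pot ?l + ?g)"
    using sum_mono[of "{..<d x}" "\<lambda>c. kappa (contract_vertex S (neighbour x (Suc c)))"
        "\<lambda>_. height_pot ?l + ?g"] kappa_child by simp
  moreover have "kappa (contract_vertex S (neighbour x 0)) + Suc total_degree * ?g \<le> height_pot ?l"
    using kappa_parent[OF assms] unfolding g .
  ultimately show ?thesis by (simp add: algebra_simps)
qed

sublocale rotor_router W None "edge_order G t" kappa
proof
  have "finite (mverts Tr)"
  proof -
    have "finite S" using finite_level by (auto simp: sinks_def down_sink_def up_sink_def)
    then show ?thesis by (simp add: verts_Tr finite_internal)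
  qed
  then show "finite (mverts W)" by (simp add: wired_tree_def contract_def)
next
  fix e assume e: "e \<in> medges W"
  have cv: "contract_vertex S v \<in> mverts W" if "v \<in> mverts Tr" for v
    using that by (auto simp: contract_vertex_def wired_tree_def contract_def)
  obtain y where y: "e = edge y 0" "y \<in> trunc_nodes G t h"
    using e by (auto simp: wired_tree_def contract_def medges_Tr)
  have "Node y \<in> mverts Tr" using y by (simp add: trunc_tree_def)
  moreover have "neighbour y 0 \<in> mverts Tr"
    using y(2) by (cases y rule: rev_cases)
      (auto simp: trunc_tree_def trunc_nodes_def snoc_in_tree_nodes)
  moreover have "mends W e = {contract_vertex S (Node y), contract_vertex S (neighbour y 0)}"
    by (simp add: y(1) wired_tree_def contract_def)
  ultimately show "\<exists>u\<in>mverts W. \<exists>v\<in>mverts W. mends W e = {u, v}" using cv by blast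
next
  show "kappa None = 0" by (simp add: kappa_def)
next
  fix v assume "v \<in> mverts W - {None}"
  then obtain x where x: "v = Some (Node x)" "x \<in> I" by (auto simp: verts_W)
  have inj: "inj_on (edge x) A" for A using edge_inj by (auto intro: inj_onI)
  show "distinct (edge_order G t v)" using x inj by (simp add: distinct_map del: upt_Suc)
  show "set (edge_order G t v) = incident_edges W v"
    using x incident_W[OF x(2)] by (simp add: atLeastLessThanSuc_atLeastAtMost del: upt_Suc)
  have "(\<Sum>e\<in>incident_edges W v. kappa (other_end W e v)) =
      (\<Sum>c\<in>{0..d x}. kappa (contract_vertex S (neighbour x c)))"
    unfolding x(1) incident_W[OF x(2)] sum.reindex[OF inj] o_def other_end_W[OF x(2)] ..
  also have "\<dots> < height_pot (length x) * Suc (d x)"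
    using kappa_superharmonic[OF x(2)] by (simp add: atLeast0AtMost)
  finally show "(\<Sum>e\<in>incident_edges W v. kappa (other_end W e v)) <
      kappa v * length (edge_order G t v)"
    using x by (simp add: kappa_def)
qed

lemma order_RR_wired: "order (RR_wired G t h) = card (recurrent_configs W None)"
  unfolding RR_wired_def by (rule order_RR)

section \<open>Acyclic rotor configurations as pointings\<close>

text \<open>The analogue for pointings of a trap of a rotor configuration.\<close>

definition stuck :: "(nat list \<Rightarrow> nat) \<Rightarrow> nat list set \<Rightarrow> bool" where
  "stuck p C \<longleftrightarrow> C \<subseteq> I \<and> C \<noteq> {} \<and> (\<forall>x\<in>C. neighbour x (p x) \<in> Node ` C)"

lemma pointing_not_stuck:
  assumes "p \<in> pointings G t h"
  shows "\<not> stuck p C"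
proof
  assume C: "stuck p C"
  \<comment> \<open>A node of C pointing down would start an infinite descent, since its child cannot point back.\<close>
  have down: "False" if "x \<in> C" "p x \<noteq> 0" for x
    using that
  proof (induction "h - length x" arbitrary: x rule: less_induct)
    case less
    obtain c where c: "p x = Suc c" using less.prems(2) not0_implies_Suc by blast
    then have child: "x @ [Suc c] \<in> C" using C less.prems(1) by (force simp: stuck_def)
    then have "x \<in> I" "x @ [Suc c] \<in> I" using C less.prems(1) by (auto simp: stuck_def)
    then have "p (x @ [Suc c]) \<noteq> 0" using assms c by (auto simp: pointings_def)
    moreover have "h - length (x @ [Suc c]) < h - length x"
      using \<open>x @ [Suc c] \<in> I\<close> by (auto simp: internal_def)
    ultimately show False using less.hyps child by blast
  qed
  \<comment> \<open>So all nodes of C point up, and C would contain the parent of its node nearest to the root.\<close>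
  have "False" if "x \<in> C" for x
    using that
  proof (induction "length x" arbitrary: x rule: less_induct)
    case less
    then have "p x = 0" using down by blast
    then have "neighbour x 0 \<in> Node ` C" using C less.prems by (force simp: stuck_def)
    then have "x \<noteq> []" "butlast x \<in> C" by (auto split: if_splits)
    then show False using less.hyps[of "butlast x"] by simp
  qed
  then show False using C by (auto simp: stuck_def)
qed

lemma pointings_iff: "p \<in> pointings G t h \<longleftrightarrow> p \<in> choices G t h \<and> (\<forall>C. \<not> stuck p C)"
proof
  assume "p \<in> pointings G t h"
  then show "p \<in> choices G t h \<and> (\<forall>C. \<not> stuck p C)"
    using pointing_not_stuck by (auto simp: pointings_def)
next
  assume p: "p \<in> choices G t h \<and> (\<forall>C. \<not> stuck p C)"
  have "p (x @ [c]) \<noteq> 0" if x: "x \<in> I" "x @ [c] \<in> I" "p x = c" for x c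
  proof
    assume "p (x @ [c]) = 0"
    moreover obtain k where "c = Suc k"
      using x(2) by (cases c) (auto simp: internal_def snoc_in_tree_nodes)
    ultimately have "stuck p {x, x @ [c]}" using x by (auto simp: stuck_def)
    then show False using p by blast
  qed
  then show "p \<in> pointings G t h" using p by (auto simp: pointings_def)
qed

lemma pointing_le: "p \<in> pointings G t h \<Longrightarrow> x \<in> I \<Longrightarrow> p x \<le> d x"
  by (auto simp: pointings_def choices_def)

definition config_of :: "(nat list \<Rightarrow> nat) \<Rightarrow> pvertex option \<Rightarrow> pvertex set" where
  "config_of p = (\<lambda>v\<in>Some ` Node ` I. case v of Some (Node x) \<Rightarrow> edge x (p x))"

lemma config_of_Node: "x \<in> I \<Longrightarrow> config_of p (Some (Node x)) = edge x (p x)"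
  by (simp add: config_of_def)

lemma choices_eqI:
  assumes "p \<in> choices G t h" "q \<in> choices G t h" "\<And>x. x \<in> I \<Longrightarrow> p x = q x"
  shows "p = q"
  using assms unfolding choices_def by (metis PiE_ext)

lemma trap_image_iff:
  assumes "C \<subseteq> I"
  shows "trap (config_of p) (Some ` Node ` C) \<longleftrightarrow> stuck p C"
proof -
  have "other_end W (config_of p (Some (Node x))) (Some (Node x)) \<in> Some ` Node ` C \<longleftrightarrow>
      neighbour x (p x) \<in> Node ` C" if "x \<in> C" for x
  proof -
    have x: "x \<in> I" using that assms by blast
    show ?thesis
      unfolding config_of_Node[OF x] other_end_W[OF x]
      using Node_notin_S assms by (force simp: contract_vertex_def)
  qed
  then show ?thesis using assms by (auto simp: trap_def stuck_def V_def verts_W)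
qed

lemma config_of_recurrent_iff:
  assumes "p \<in> choices G t h"
  shows "config_of p \<in> recurrent_configs W None \<longleftrightarrow> p \<in> pointings G t h"
proof -
  have "config_of p \<in> rotor_configs W None"
    unfolding rotor_configs_def verts_W
  proof (rule PiE_I)
    fix v assume "v \<in> Some ` Node ` I"
    then obtain x where x: "v = Some (Node x)" "x \<in> I" by blast
    show "config_of p v \<in> incident_edges W v"
      unfolding x(1) config_of_Node[OF x(2)] incident_W[OF x(2)]
      using assms x(2) by (auto simp: choices_def)
  qed (simp add: config_of_def)
  moreover have "(\<exists>C. trap (config_of p) C) \<longleftrightarrow> (\<exists>C. stuck p C)"
  proof
    assume "\<exists>C. trap (config_of p) C"
    then obtain C where C: "trap (config_of p) C" by blast
    then have "C \<subseteq> (\<lambda>x. Some (Node x)) ` I" by (auto simp: trap_def V_def verts_W)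
    then obtain C' where "C' \<subseteq> I" "C = Some ` Node ` C'" by (auto simp: subset_image_iff image_image)
    then show "\<exists>C. stuck p C" using C trap_image_iff by blast
  next
    assume "\<exists>C. stuck p C"
    then show "\<exists>C. trap (config_of p) C" using trap_image_iff by (metis stuck_def)
  qed
  ultimately show ?thesis using assms unfolding recurrent_iff pointings_iff by blast
qed

lemma card_recurrent: "card (recurrent_configs W None) = card (pointings G t h)"
proof -
  have "bij_betw config_of (pointings G t h) (recurrent_configs W None)"
  proof (rule bij_betw_imageI)
    show "inj_on config_of (pointings G t h)"
    proof (rule inj_onI)
      fix p q assume pq: "p \<in> pointings G t h" "q \<in> pointings G t h" "config_of p = config_of q"
      show "p = q"
      proof (rule choices_eqI)
        fix x assume x: "x \<in> I"
        have "edge x (p x) = edge x (q x)"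
          using pq(3) config_of_Node[OF x, of p] config_of_Node[OF x, of q] by simp
        then show "p x = q x" by (simp only: edge_inj)
      qed (use pq in \<open>auto simp: pointings_def\<close>)
    qed
    show "config_of ` pointings G t h = recurrent_configs W None"
    proof
      show "config_of ` pointings G t h \<subseteq> recurrent_configs W None"
        using config_of_recurrent_iff by (auto simp: pointings_iff)
      show "recurrent_configs W None \<subseteq> config_of ` pointings G t h"
      proof
        fix \<rho> assume rec: "\<rho> \<in> recurrent_configs W None"
        then have \<rho>: "\<rho> \<in> rotor_configs W None" by (simp add: recurrent_iff)
        have "\<exists>c. c \<le> d x \<and> \<rho> (Some (Node x)) = edge x c" if x: "x \<in> I" for x
        proof -
          have "\<rho> (Some (Node x)) \<in> incident_edges W (Some (Node x))"
            using x by (intro PiE_mem[OF \<rho>[unfolded rotor_configs_def verts_W]]) blast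
          then obtain c where "\<rho> (Some (Node x)) = edge x c" "c \<in> {0..d x}"
            unfolding incident_W[OF x] by (rule imageE)
          then show ?thesis by (intro exI[of _ c] conjI) simp_all
        qed
        then obtain q where q: "\<And>x. x \<in> I \<Longrightarrow> q x \<le> d x \<and> \<rho> (Some (Node x)) = edge x (q x)" by metis
        let ?p = "restrict q I"
        have p: "?p \<in> choices G t h" using q by (auto simp: choices_def)
        have "config_of ?p = \<rho>"
        proof
          fix v show "config_of ?p v = \<rho> v"
          proof (cases "v \<in> Some ` Node ` I")
            case True
            then obtain x where x: "v = Some (Node x)" "x \<in> I" by blast
            then have "?p x = q x" by simp
            then show ?thesis unfolding x(1) config_of_Node[OF x(2)] using q[OF x(2)] by simp
          next
            case False
            then have "config_of ?p v = undefined"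
              unfolding config_of_def restrict_apply by (rule if_not_P)
            moreover have "\<rho> v = undefined"
              by (rule PiE_arb[OF \<rho>[unfolded rotor_configs_def verts_W] False])
            ultimately show ?thesis by simp
          qed
        qed
        then show "\<rho> \<in> config_of ` pointings G t h"
          using rec config_of_recurrent_iff[OF p] by (metis imageI)
      qed
    qed
  qed
  then show ?thesis by (metis bij_betw_same_card)
qed

section \<open>Rooted forests as pointings\<close>

abbreviation desc :: "nat list \<Rightarrow> pvertex set" where "desc x \<equiv> {Node (x @ y) | y. True}"

text \<open>In a tree, the edge above x is the only edge between the descendants of x and the rest. This
  cut property is used in place of explicit paths and cycles.\<close>

lemma edge_crosses_desc: "Node y \<in> desc x \<and> neighbour y 0 \<notin> desc x \<or>
    Node y \<notin> desc x \<and> neighbour y 0 \<in> desc x \<longleftrightarrow> y = x"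
proof (cases y rule: rev_cases)
  case (snoc z c)
  then show ?thesis by (auto simp: append_eq_append_conv2 Cons_eq_append_conv append_eq_Cons_conv)
qed auto

lemma edge_within_desc:
  assumes "e \<in> medges Tr" "e \<noteq> edge x 0" "e = {u, v}"
  shows "u \<in> desc x \<longleftrightarrow> v \<in> desc x"
proof -
  obtain y where y: "e = edge y 0" using assms(1) by (auto simp: medges_Tr)
  then have "y \<noteq> x" using assms(2) by auto
  then have "Node y \<in> desc x \<longleftrightarrow> neighbour y 0 \<in> desc x" using edge_crosses_desc[of y x] by blast
  then show ?thesis using y assms(3) by (auto simp: doubleton_eq_iff simp del: neighbour.simps)
qed

lemma connected_within_desc:
  assumes "A \<subseteq> medges Tr" "edge x 0 \<notin> A" "(u, v) \<in> connected_by Tr A"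
  shows "u \<in> desc x \<longleftrightarrow> v \<in> desc x"
  using assms(3) unfolding connected_by_def
proof (induction rule: rtrancl_induct)
  case (step v w)
  then obtain e where e: "e \<in> A" "e = {v, w}" by auto
  then have "e \<in> medges Tr" "e \<noteq> edge x 0" using assms(1,2) by (metis subsetD)+
  then have "v \<in> desc x \<longleftrightarrow> w \<in> desc x" using e(2) by (rule edge_within_desc)
  then show ?case using step.IH by (simp only:)
qed simp

text \<open>The edges of a cycle other than the first connect the ends of the first edge. If the first edge
  is the edge above x, they cannot leave the set of descendants of x, but its ends lie on
  different sides.\<close>

lemma no_cycle:
  assumes "A \<subseteq> medges Tr"
  shows "\<not> is_cycle Tr A vs es"
proof
  assume c: "is_cycle Tr A vs es"
  let ?n = "length es"
  have n: "0 < ?n" using c by (auto simp: is_cycle_def)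
  have es: "es ! k = {vs ! k, vs ! (Suc k mod ?n)}" if "k < ?n" for k
    using c that by (auto simp: is_cycle_def)
  have dist: "distinct es" and "set es \<subseteq> A" using c by (auto simp: is_cycle_def)
  then have edges: "es ! k \<in> medges Tr" if "k < ?n" for k
    using that assms nth_mem by blast
  obtain x where x: "es ! 0 = edge x 0" using edges[OF n] unfolding medges_Tr by blast
  have other: "vs ! k \<in> desc x \<longleftrightarrow> vs ! (Suc k mod ?n) \<in> desc x" if "0 < k" "k < ?n" for k
  proof (rule edge_within_desc[OF _ _ es])
    show "es ! k \<in> medges Tr" using that(2) by (rule edges)
    show "es ! k \<noteq> edge x 0"
      unfolding x[symmetric] using nth_eq_iff_index_eq[OF dist that(2) n] that(1) by simp
  qed (use that in auto)
  have "vs ! (1 mod ?n) \<in> desc x \<longleftrightarrow> vs ! (Suc k mod ?n) \<in> desc x" if "k < ?n" for k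
    using that
  proof (induction k)
    case (Suc k)
    then show ?case using other[of "Suc k"] by simp
  qed simp
  from this[of "?n - 1"] have "vs ! (1 mod ?n) \<in> desc x \<longleftrightarrow> vs ! 0 \<in> desc x" using n by simp
  moreover have "edge x 0 = {vs ! 0, vs ! (1 mod ?n)}" using es[OF n] x by simp
  then have "Node x = vs ! 0 \<and> neighbour x 0 = vs ! (1 mod ?n) \<or>
      Node x = vs ! (1 mod ?n) \<and> neighbour x 0 = vs ! 0"
    unfolding doubleton_eq_iff .
  ultimately have "Node x \<in> desc x \<longleftrightarrow> neighbour x 0 \<in> desc x"
    by (elim disjE conjE) (simp_all only:)
  then show False using edge_crosses_desc[of x x] by argo
qed

lemma spanning_forest_iff: "spanning_forest Tr A \<longleftrightarrow> A \<subseteq> medges Tr"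
  using no_cycle by (auto simp: spanning_forest_def)

definition forest_of :: "(nat list \<Rightarrow> nat) \<Rightarrow> pvertex set set" where
  "forest_of p = (\<lambda>x. edge x (p x)) ` I"

lemma forest_of_subset: "p \<in> pointings G t h \<Longrightarrow> forest_of p \<subseteq> medges Tr"
  using edges_at_Node pointing_le by (fastforce simp: forest_of_def)

lemma connected_neighbour: "x \<in> I \<Longrightarrow> (Node x, neighbour x (p x)) \<in> connected_by Tr (forest_of p)"
  by (rule connected_edge[of "edge x (p x)"]) (auto simp: forest_of_def)

text \<open>If x is not connected to a sink, neither is the node to which x points. Such nodes would
  form a closed set.\<close>

lemma forest_of_reaches_sink:
  assumes p: "p \<in> pointings G t h" and v: "v \<in> mverts Tr"
  shows "\<exists>s\<in>S. (v, s) \<in> connected_by Tr (forest_of p)"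
proof (rule ccontr)
  assume no: "\<not> (\<exists>s\<in>S. (v, s) \<in> connected_by Tr (forest_of p))"
  define C where "C = {x \<in> I. \<not> (\<exists>s\<in>S. (Node x, s) \<in> connected_by Tr (forest_of p))}"
  have "neighbour x (p x) \<in> Node ` C" if x: "x \<in> C" for x
  proof -
    have xI: "x \<in> I" using x by (simp add: C_def)
    have no_sink: "\<not> (\<exists>s\<in>S. (neighbour x (p x), s) \<in> connected_by Tr (forest_of p))"
      using x connected_trans[OF connected_neighbour[OF xI]] unfolding C_def by blast
    have "neighbour x (p x) \<notin> S"
    proof
      assume "neighbour x (p x) \<in> S"
      then show False using no_sink unfolding connected_by_def by blast
    qed
    then obtain y where y: "neighbour x (p x) = Node y" "y \<in> I"
      using neighbour_in_verts[OF xI pointing_le[OF p xI]] unfolding verts_Tr by blast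
    then have "y \<in> C" using no_sink unfolding C_def by simp
    then show ?thesis unfolding y(1) by (rule imageI)
  qed
  moreover have "C \<noteq> {}"
  proof -
    have "v \<notin> S" using no by (auto simp: connected_by_def)
    then show ?thesis using v no unfolding verts_Tr C_def by blast
  qed
  ultimately have "stuck p C" by (auto simp: stuck_def C_def)
  then show False using pointing_not_stuck[OF p] by blast
qed

text \<open>The nodes that reach s by following the pointing form a union of components: along an edge from
  x to the node to which x points, both ends reach the same sink.\<close>

lemma forest_of_sink_unique:
  assumes "s \<in> S" "s' \<in> S" "(s, s') \<in> connected_by Tr (forest_of p)"
  shows "s = s'"
proof -
  \<comment> \<open>One step along the pointing; sinks have no successor.\<close>
  define F where "F = {(Node x, neighbour x (p x)) | x. x \<in> I}"
  have F_S: "(a, b) \<notin> F" if "a \<in> S" for a b using that Node_notin_S by (auto simp: F_def)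
  have "(s', s) \<in> F\<^sup>*"
    using assms(3) unfolding connected_by_def
  proof (induction rule: rtrancl_induct)
    case (step v w)
    then obtain x where x: "x \<in> I" "{v, w} = edge x (p x)" by (auto simp: forest_of_def)
    then have fx: "(Node x, neighbour x (p x)) \<in> F" by (auto simp: F_def)
    show ?case
    proof (cases "v = Node x")
      case True
      then have w: "w = neighbour x (p x)" using x(2) neighbour_neq[of x "p x"] by (auto simp: doubleton_eq_iff)
      have "v \<noteq> s" using F_S[OF assms(1)] fx True by blast
      then obtain w' where "(v, w') \<in> F" "(w', s) \<in> F\<^sup>*" using step.IH by (meson converse_rtranclE)
      then show ?thesis using True w by (auto simp: F_def)
    next
      case False
      then have "(w, v) \<in> F" using x fx by (auto simp: doubleton_eq_iff)
      then show ?thesis using step.IH by (rule converse_rtrancl_into_rtrancl)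
    qed
  qed simp
  then show ?thesis using F_S[OF assms(2)] by (metis converse_rtranclE)
qed

lemma rooted_forest_of:
  assumes "p \<in> pointings G t h"
  shows "rooted_at Tr (forest_of p) S"
  unfolding rooted_at_def conn_component_def
proof
  fix v assume "v \<in> mverts Tr"
  then obtain s where s: "s \<in> S" "(v, s) \<in> connected_by Tr (forest_of p)"
    using forest_of_reaches_sink[OF assms] by blast
  show "\<exists>!s. s \<in> S \<inter> {w \<in> mverts Tr. (v, w) \<in> connected_by Tr (forest_of p)}"
  proof (rule ex1I[of _ s])
    show "s \<in> S \<inter> {w \<in> mverts Tr. (v, w) \<in> connected_by Tr (forest_of p)}" using s S_subset by blast
    fix s' assume "s' \<in> S \<inter> {w \<in> mverts Tr. (v, w) \<in> connected_by Tr (forest_of p)}"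
    then have s': "s' \<in> S" "(v, s') \<in> connected_by Tr (forest_of p)" by simp_all
    show "s' = s"
      by (rule forest_of_sink_unique[OF s'(1) s(1) connected_trans[OF connected_sym[OF s'(2)] s(2)]])
  qed
qed

text \<open>Where p and q differ at x, the edge chosen by q at x must be chosen by p at its other end
  y, and q cannot choose it at y as well. So q leads from each node at which p and q differ to
  another such node.\<close>

lemma forest_of_inj: "inj_on forest_of (pointings G t h)"
proof (rule inj_onI)
  fix p q assume p: "p \<in> pointings G t h" and q: "q \<in> pointings G t h" and eq: "forest_of p = forest_of q"
  define C where "C = {x \<in> I. p x \<noteq> q x}"
  have "neighbour x (q x) \<in> Node ` C" if "x \<in> C" for x
  proof -
    have x: "x \<in> I" "p x \<noteq> q x" using that by (auto simp: C_def)
    have "edge x (q x) \<in> forest_of p" unfolding eq using x(1) by (simp add: forest_of_def)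
    then obtain y where y: "y \<in> I" "edge x (q x) = edge y (p y)" by (auto simp: forest_of_def)
    have "x \<noteq> y" using y x(2) edge_inj by metis
    then have xy: "neighbour x (q x) = Node y" "neighbour y (p y) = Node x"
      using y(2) by (auto simp: doubleton_eq_iff)
    have "p y \<noteq> q y"
    proof
      assume "p y = q y"
      then have "stuck q {x, y}" using xy x(1) y(1) by (auto simp: stuck_def)
      then show False using pointing_not_stuck[OF q] by blast
    qed
    then show ?thesis using xy(1) y(1) by (auto simp: C_def)
  qed
  then have "C = {}" using pointing_not_stuck[OF q, of C] by (auto simp: stuck_def C_def)
  then show "p = q" using p q by (intro choices_eqI) (auto simp: pointings_def C_def)
qed

text \<open>Given a rooted forest A, let every node point along an edge of A that decreases its distance
  m to the sinks. The chosen edges exhaust A: the ends of a further edge e in A would both be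
  connected to sinks without e. As A is rooted these are the same sink, so the ends of e would be
  connected without e, against the cut property.\<close>

lemma forest_of_surj:
  assumes A: "A \<subseteq> medges Tr" and rooted: "rooted_at Tr A S"
  shows "A \<in> forest_of ` pointings G t h"
proof -
  define R where "R = {(u, v). \<exists>e\<in>A. mends Tr e = {u, v}}"
  define m where "m v = (LEAST n. \<exists>s\<in>S. (v, s) \<in> R ^^ n)" for v
  have "\<exists>c \<le> d x. edge x c \<in> A \<and> m (neighbour x c) < m (Node x)" if x: "x \<in> I" for x
  proof -
    have "Node x \<in> mverts Tr" using x by (simp add: verts_Tr)
    then obtain s where s: "s \<in> S" "(Node x, s) \<in> R\<^sup>*"
      using rooted by (auto simp: rooted_at_def conn_component_def connected_by_def R_def)
    then have "\<exists>n. \<exists>s\<in>S. (Node x, s) \<in> R ^^ n" by (meson rtrancl_imp_relpow)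
    then have "\<exists>s\<in>S. (Node x, s) \<in> R ^^ m (Node x)" unfolding m_def by (rule LeastI_ex)
    then obtain s' where s': "s' \<in> S" "(Node x, s') \<in> R ^^ m (Node x)" by blast
    have "m (Node x) \<noteq> 0"
    proof
      assume "m (Node x) = 0"
      then show False using s' Node_notin_S[OF x] by simp
    qed
    then obtain n where n: "m (Node x) = Suc n" using not0_implies_Suc by blast
    then obtain w where w: "(Node x, w) \<in> R" "(w, s') \<in> R ^^ n" using s'(2) relpow_Suc_D2 by metis
    have "m w \<le> n" unfolding m_def using w(2) s'(1) by (intro Least_le) blast
    moreover have e: "{Node x, w} \<in> A" using w(1) by (auto simp: R_def)
    ultimately show ?thesis
    proof -
      have "{Node x, w} \<in> edge x ` {0..d x}" using e A edges_at_Node[OF x] by blast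
      then obtain c where c: "c \<le> d x" "{Node x, w} = edge x c" by auto
      then have "w = neighbour x c" by (auto simp: doubleton_eq_iff)
      then show ?thesis using c e \<open>m w \<le> n\<close> n by auto
    qed
  qed
  then obtain q where q: "\<And>x. x \<in> I \<Longrightarrow>
      q x \<le> d x \<and> edge x (q x) \<in> A \<and> m (neighbour x (q x)) < m (Node x)" by metis
  define p where "p = restrict q I"
  have "\<not> stuck p C" for C
  proof
    assume C: "stuck p C"
    then obtain x where x: "x \<in> C" "\<And>y. y \<in> C \<Longrightarrow> m (Node x) \<le> m (Node y)"
      using arg_min_nat_lemma[of "\<lambda>x. x \<in> C" _ "\<lambda>x. m (Node x)"] by (metis ex_in_conv stuck_def)
    then have "x \<in> I" using C by (auto simp: stuck_def)
    moreover obtain y where "neighbour x (p x) = Node y" "y \<in> C" using C x(1) by (auto simp: stuck_def)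
    ultimately show False using q[of x] x(2)[of y] by (simp add: p_def)
  qed
  then have p: "p \<in> pointings G t h" using q by (auto simp: pointings_iff choices_def p_def)
  have sub: "forest_of p \<subseteq> A" using q by (auto simp: forest_of_def p_def)
  have "A \<subseteq> forest_of p"
  proof
    fix e assume e: "e \<in> A"
    show "e \<in> forest_of p"
    proof (rule ccontr)
      assume ne: "e \<notin> forest_of p"
      obtain y where y: "e = edge y 0" "y \<in> trunc_nodes G t h" using e A by (auto simp: medges_Tr)
      have v: "Node y \<in> mverts Tr" "neighbour y 0 \<in> mverts Tr"
        using y(2) by (cases y rule: rev_cases;
            auto simp: trunc_tree_def trunc_nodes_def snoc_in_tree_nodes)+
      obtain s s' where s: "s \<in> S" "(Node y, s) \<in> connected_by Tr (forest_of p)"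
          "s' \<in> S" "(neighbour y 0, s') \<in> connected_by Tr (forest_of p)"
        using forest_of_reaches_sink[OF p v(1)] forest_of_reaches_sink[OF p v(2)] by blast
      have "(Node y, neighbour y 0) \<in> connected_by Tr A"
        using e y(1) by (intro connected_edge[of e]) auto
      then have "(Node y, s) \<in> connected_by Tr A" "(Node y, s') \<in> connected_by Tr A"
        using connected_mono[OF sub s(2)] connected_trans[OF _ connected_mono[OF sub s(4)]] by auto
      then have "s = s'"
        using rooted v(1) s(1,3) S_subset unfolding rooted_at_def conn_component_def by blast
      then have "(Node y, neighbour y 0) \<in> connected_by Tr (forest_of p)"
        using connected_trans[OF s(2) connected_sym[OF s(4)[folded \<open>s = s'\<close>]]] by simp
      then show False
        using connected_within_desc[OF forest_of_subset[OF p] ne[unfolded y(1)]]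
          edge_crosses_desc[of y y] by metis
    qed
  qed
  then show ?thesis using sub p by blast
qed

lemma rooted_forests_eq:
  "{A. spanning_forest Tr A \<and> rooted_at Tr A S \<and> P A} = forest_of ` {p \<in> pointings G t h. P (forest_of p)}"
  using forest_of_surj rooted_forest_of forest_of_subset unfolding spanning_forest_iff by blast

lemma card_rooted_forests:
  "card {A. spanning_forest Tr A \<and> rooted_at Tr A S \<and> P A} = card {p \<in> pointings G t h. P (forest_of p)}"
  unfolding rooted_forests_eq
  by (rule card_image) (rule inj_on_subset[OF forest_of_inj], blast)

lemma root_edge_in_forest_of_iff: "edge [] 0 \<in> forest_of p \<longleftrightarrow> p [] = 0"
proof
  assume "edge [] 0 \<in> forest_of p"
  then obtain x where x: "{Node [], Ancestor} = edge x (p x)" by (auto simp: forest_of_def)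
  have "neighbour x c = Ancestor \<longleftrightarrow> x = [] \<and> c = 0" for c by (cases c) auto
  moreover have "Ancestor \<in> edge x (p x)" unfolding x[symmetric] by (rule insertI2) (rule insertI1)
  then have "neighbour x (p x) = Ancestor" by simp
  ultimately show "p [] = 0" by blast
next
  assume "p [] = 0"
  then show "edge [] 0 \<in> forest_of p"
    unfolding forest_of_def by (intro image_eqI[where x = "[]"]) (simp_all add: root_in_I)
qed

lemma F_down_eq: "F_down G t h = card {p \<in> pointings G t h. p [] = 0}"
  using card_rooted_forests[of "\<lambda>A. edge [] 0 \<in> A"] root_edge_in_forest_of_iff
  by (simp add: F_down_def)

text \<open>If the root does not point to the ancestor, the edge between them is missing from the forest,
  so by the cut property the sink connected to the root is not the ancestor.\<close>

lemma root_connected_up_iff: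
  assumes p: "p \<in> pointings G t h"
  shows "(\<exists>s\<in>up_sink G t h. (Node [], s) \<in> connected_by Tr (forest_of p)) \<longleftrightarrow> p [] \<noteq> 0"
proof
  assume "\<exists>s\<in>up_sink G t h. (Node [], s) \<in> connected_by Tr (forest_of p)"
  then obtain s where s: "s \<in> up_sink G t h" "(Node [], s) \<in> connected_by Tr (forest_of p)" by blast
  show "p [] \<noteq> 0"
  proof
    assume "p [] = 0"
    then have "(Node [], Ancestor) \<in> connected_by Tr (forest_of p)"
      using connected_neighbour[OF root_in_I, of p] by simp
    then have "(Ancestor, s) \<in> connected_by Tr (forest_of p)"
      using connected_trans[OF connected_sym s(2)] by blast
    then have "Ancestor = s"
      using s(1) by (intro forest_of_sink_unique) (auto simp: sinks_def down_sink_def)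
    then show False using s(1) by (auto simp: up_sink_def)
  qed
next
  assume "p [] \<noteq> 0"
  then have "edge [] 0 \<notin> forest_of p" using root_edge_in_forest_of_iff by simp
  then have "(Node [], Ancestor) \<notin> connected_by Tr (forest_of p)"
    using connected_within_desc[OF forest_of_subset[OF p], of "[]" "Node []" Ancestor] by blast
  moreover obtain s where "s \<in> S" "(Node [], s) \<in> connected_by Tr (forest_of p)"
    using forest_of_reaches_sink[OF p, of "Node []"] root_in_I by (auto simp: verts_Tr)
  ultimately show "\<exists>s\<in>up_sink G t h. (Node [], s) \<in> connected_by Tr (forest_of p)"
    by (auto simp: sinks_def down_sink_def)
qed

lemma F_up_eq: "F_up G t h = card {p \<in> pointings G t h. p [] \<noteq> 0}"
proof -
  have "F_up G t h = card {p \<in> pointings G t h.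
      \<exists>s\<in>up_sink G t h. (Node [], s) \<in> connected_by Tr (forest_of p)}"
    unfolding F_up_def by (rule card_rooted_forests)
  also have "{p \<in> pointings G t h. \<exists>s\<in>up_sink G t h. (Node [], s) \<in> connected_by Tr (forest_of p)} =
      {p \<in> pointings G t h. p [] \<noteq> 0}"
    using root_connected_up_iff by blast
  finally show ?thesis .
qed

lemma F_down_plus_F_up: "F_down G t h + F_up G t h = card (pointings G t h)"
  by (simp only: F_down_eq F_up_eq card_pointings_split[of G t h])

end

section \<open>Counting pointings recursively\<close>

definition subtree :: "(nat list \<Rightarrow> 'a) \<Rightarrow> nat \<Rightarrow> nat list \<Rightarrow> 'a" where
  "subtree t c x = t (c # x)"

lemma Cons_in_tree_nodes:
  "c # x \<in> tree_nodes G t \<longleftrightarrow> c \<in> {1..out_degree G (t [])} \<and> x \<in> tree_nodes G (subtree t c)"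
proof (induction x rule: rev_induct)
  case Nil
  show ?case using snoc_in_tree_nodes[of "[]" c G t] by (simp add: tree_nodes.root)
next
  case (snoc b x)
  have "c # x @ [b] \<in> tree_nodes G t \<longleftrightarrow>
      c # x \<in> tree_nodes G t \<and> b \<in> {1..out_degree G (t (c # x))}"
    using snoc_in_tree_nodes[of "c # x" b G t] by (simp only: append_Cons)
  moreover have "x @ [b] \<in> tree_nodes G (subtree t c) \<longleftrightarrow>
      x \<in> tree_nodes G (subtree t c) \<and> b \<in> {1..out_degree G (t (c # x))}"
    unfolding snoc_in_tree_nodes subtree_def[of t c x] ..
  ultimately show ?case using snoc by blast
qed

lemma Cons_in_internal:
  "c # x \<in> internal G t (Suc h) \<longleftrightarrow>
    c \<in> {1..out_degree G (t [])} \<and> x \<in> internal G (subtree t c) h"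
  by (auto simp: internal_def Cons_in_tree_nodes)

lemma Nil_in_internal: "[] \<in> internal G t h \<longleftrightarrow> 0 < h"
  by (auto simp: internal_def tree_nodes.root)

lemma directed_cover_subtree:
  assumes "directed_cover G i t" "c \<in> {1..out_degree G i}"
  shows "directed_cover G (t [c]) (subtree t c)"
  unfolding directed_cover_def
proof (intro conjI ballI)
  fix x j assume x: "x \<in> tree_nodes G (subtree t c)" and j: "j \<in> verts G"
  have "t [] = i" using assms(1) by (simp add: directed_cover_def)
  then have "c # x \<in> tree_nodes G t" using x assms(2) by (simp add: Cons_in_tree_nodes)
  then have "card {b \<in> {1..out_degree G (t (c # x))}. t ((c # x) @ [b]) = j} = adj G (t (c # x)) j"
    using assms(1) j unfolding directed_cover_def by blast
  then show "card {b \<in> {1..out_degree G (subtree t c x)}. subtree t c (x @ [b]) = j} =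
      adj G (subtree t c x) j"
    by (simp add: subtree_def[of t c])
qed (simp add: subtree_def)

text \<open>The pointings in which the root does not point to its ancestor. For \<open>h = 0\<close> the root is itself
  an upper sink, and its single (empty) pointing belongs here; with this convention
  the recursion also covers the step from height 0 to height 1.\<close>

definition up_pointings :: "('a, 'b) pre_digraph \<Rightarrow> (nat list \<Rightarrow> 'a) \<Rightarrow> nat \<Rightarrow> (nat list \<Rightarrow> nat) set" where
  "up_pointings G t h = {p \<in> pointings G t h. h = 0 \<or> p [] \<noteq> 0}"

lemma pointings_0: "pointings G t 0 = {\<lambda>_. undefined}"
  by (auto simp: pointings_def choices_def internal_def)

lemma card_pointings_pos: "0 < card (pointings G t h)"
proof -
  have "(\<lambda>x\<in>internal G t h. 0) \<in> pointings G t h"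
    by (auto simp: pointings_def choices_def) (auto simp: internal_def snoc_in_tree_nodes)
  then show ?thesis using finite_pointings[of G t h] by (auto simp: card_gt_0_iff)
qed

lemma pointings_at_child:
  assumes p: "p \<in> pointings G t (Suc h)" and c: "c \<in> {1..out_degree G (t [])}"
  shows "(\<lambda>x. p (c # x)) \<in> (if c = p [] then up_pointings G (subtree t c) h else pointings G (subtree t c) h)"
proof -
  note I = Cons_in_internal[of c _ G t h]
  have pc: "p \<in> choices G t (Suc h)" using p by (simp add: pointings_def)
  have noback: "p (x @ [b]) \<noteq> 0"
    if "x \<in> internal G t (Suc h)" "x @ [b] \<in> internal G t (Suc h)" "p x = b" for x b
    using p that by (auto simp: pointings_def)
  have "(\<lambda>x. p (c # x)) \<in> choices G (subtree t c) h"
    unfolding choices_def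
  proof (rule PiE_I)
    fix x assume "x \<in> internal G (subtree t c) h"
    then have "c # x \<in> internal G t (Suc h)" using I c by simp
    then show "p (c # x) \<in> {0..out_degree G (subtree t c x)}"
      using pc unfolding choices_def subtree_def[of t c x] by (rule PiE_mem[rotated])
  next
    fix x assume "x \<notin> internal G (subtree t c) h"
    then have "c # x \<notin> internal G t (Suc h)" using I by simp
    then show "p (c # x) = undefined" using pc unfolding choices_def by (rule PiE_arb[rotated])
  qed
  moreover have "p (c # x @ [b]) \<noteq> 0"
    if "x \<in> internal G (subtree t c) h" "x @ [b] \<in> internal G (subtree t c) h" "p (c # x) = b" for x b
    using noback[of "c # x" b] that I c by simp
  ultimately have mem: "(\<lambda>x. p (c # x)) \<in> pointings G (subtree t c) h"
    by (simp add: pointings_def)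
  have "p [c] \<noteq> 0" if "c = p []" "0 < h"
  proof -
    have "[] \<in> internal G t (Suc h)" "[] @ [c] \<in> internal G t (Suc h)"
      using that(2) c by (simp_all add: Cons_in_internal Nil_in_internal)
    then have "p ([] @ [c]) \<noteq> 0" using that(1)[symmetric] by (rule noback)
    then show ?thesis by simp
  qed
  then show ?thesis using mem unfolding up_pointings_def by (cases "h = 0") auto
qed

text \<open>The inverse of restricting a pointing to the subtrees, when the root makes the choice j.\<close>

definition join_pointings ::
  "nat \<Rightarrow> nat \<Rightarrow> (nat \<Rightarrow> nat list \<Rightarrow> nat) \<Rightarrow> nat list \<Rightarrow> nat" where
  "join_pointings n j f x =
     (case x of [] \<Rightarrow> j | c # y \<Rightarrow> if c \<in> {1..n} then f c y else undefined)"

lemma join_pointings_in: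
  assumes j: "j \<le> out_degree G (t [])"
    and f: "\<And>c. c \<in> {1..out_degree G (t [])} \<Longrightarrow>
      f c \<in> (if c = j then up_pointings G (subtree t c) h else pointings G (subtree t c) h)"
  shows "join_pointings (out_degree G (t [])) j f \<in> pointings G t (Suc h)"
proof -
  let ?n = "out_degree G (t [])" and ?p = "join_pointings (out_degree G (t [])) j f"
  have fp: "f c \<in> pointings G (subtree t c) h" if "c \<in> {1..?n}" for c
    using f[OF that] by (auto simp: up_pointings_def split: if_splits)
  have fc: "f c \<in> choices G (subtree t c) h" if "c \<in> {1..?n}" for c
    using fp[OF that] by (simp add: pointings_def)
  have "?p \<in> choices G t (Suc h)"
    unfolding choices_def
  proof (rule PiE_I)
    fix x assume x: "x \<in> internal G t (Suc h)"
    show "?p x \<in> {0..out_degree G (t x)}"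
    proof (cases x)
      case Nil
      then show ?thesis using j by (simp add: join_pointings_def)
    next
      case (Cons c y)
      then have c: "c \<in> {1..?n}" "y \<in> internal G (subtree t c) h" 
        using x unfolding Cons Cons_in_internal by blast+
      have "f c y \<in> {0..out_degree G (t (c # y))}"
        using PiE_mem[OF fc[OF c(1), unfolded choices_def] c(2)] by (simp only: subtree_def)
      then show ?thesis using c(1) Cons by (simp add: join_pointings_def)
    qed
  next
    fix x assume x: "x \<notin> internal G t (Suc h)"
    show "?p x = undefined"
    proof (cases x)
      case Nil
      then show ?thesis using x Nil_in_internal by blast
    next
      case (Cons c y)
      show ?thesis
      proof (cases "c \<in> {1..?n}")
        case True
        then have "y \<notin> internal G (subtree t c) h" using x Cons Cons_in_internal by blast
        then have "f c y = undefined" by (rule PiE_arb[OF fc[OF True, unfolded choices_def]])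
        then show ?thesis using Cons by (simp add: join_pointings_def)
      next
        case False
        then show ?thesis unfolding Cons join_pointings_def list.case by (rule if_not_P)
      qed
    qed
  qed
  moreover have "?p (x @ [b]) \<noteq> 0"
    if x: "x \<in> internal G t (Suc h)" "x @ [b] \<in> internal G t (Suc h)" "?p x = b" for x b
  proof (cases x)
    case Nil
    then have b: "b = j" "b \<in> {1..?n}" "0 < h"
      using x(2,3) by (auto simp: Cons_in_internal Nil_in_internal join_pointings_def)
    then have "f b [] \<noteq> 0" using f[OF b(2)] by (auto simp: up_pointings_def)
    then show ?thesis using Nil b by (simp add: join_pointings_def)
  next
    case (Cons c y)
    then have c: "c \<in> {1..?n}" "y \<in> internal G (subtree t c) h" "y @ [b] \<in> internal G (subtree t c) h"
      using x(1,2) by (auto simp: Cons_in_internal)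
    moreover have "f c y = b" using x(3) Cons c(1) by (simp add: join_pointings_def)
    ultimately have "f c (y @ [b]) \<noteq> 0" using fp[OF c(1)] unfolding pointings_def by blast
    then show ?thesis using Cons c(1) by (simp add: join_pointings_def)
  qed
  ultimately show ?thesis by (simp add: pointings_def)
qed

text \<open>Restriction to the subtrees is a bijection onto all families in which the child j, if
  \<open>j > 0\<close>, does not point back.\<close>

lemma card_pointings_root:
  assumes j: "j \<le> out_degree G (t [])"
  shows "card {p \<in> pointings G t (Suc h). p [] = j} =
    (\<Prod>c\<in>{1..out_degree G (t [])}.
      if c = j then card (up_pointings G (subtree t c) h) else card (pointings G (subtree t c) h))"
proof -
  let ?n = "out_degree G (t [])"
  let ?B = "\<lambda>c. if c = j then up_pointings G (subtree t c) h else pointings G (subtree t c) h"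
  let ?split = "\<lambda>p. \<lambda>c\<in>{1..?n}. \<lambda>x. p (c # x)"
  have "bij_betw ?split {p \<in> pointings G t (Suc h). p [] = j} (\<Pi>\<^sub>E c\<in>{1..?n}. ?B c)"
  proof (rule bij_betw_byWitness[where f' = "join_pointings ?n j"])
    show "\<forall>p\<in>{p \<in> pointings G t (Suc h). p [] = j}. join_pointings ?n j (?split p) = p"
    proof
      fix p assume p: "p \<in> {p \<in> pointings G t (Suc h). p [] = j}"
      then have "p \<in> choices G t (Suc h)" by (simp add: pointings_def)
      then have undef: "p x = undefined" if "x \<notin> internal G t (Suc h)" for x
        using that unfolding choices_def by (rule PiE_arb)
      show "join_pointings ?n j (?split p) = p"
      proof
        fix x show "join_pointings ?n j (?split p) x = p x"
          using p undef[of x] by (cases x) (auto simp: join_pointings_def Cons_in_internal)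
      qed
    qed
    show "\<forall>f\<in>(\<Pi>\<^sub>E c\<in>{1..?n}. ?B c). ?split (join_pointings ?n j f) = f"
    proof
      fix f assume f: "f \<in> (\<Pi>\<^sub>E c\<in>{1..?n}. ?B c)"
      show "?split (join_pointings ?n j f) = f"
      proof
        fix c show "?split (join_pointings ?n j f) c = f c"
          using PiE_arb[OF f, of c] by (cases "c \<in> {1..?n}") (auto simp: join_pointings_def)
      qed
    qed
    show "?split ` {p \<in> pointings G t (Suc h). p [] = j} \<subseteq> (\<Pi>\<^sub>E c\<in>{1..?n}. ?B c)"
    proof (rule image_subsetI, rule PiE_I)
      fix p c assume "p \<in> {p \<in> pointings G t (Suc h). p [] = j}" and c: "c \<in> {1..?n}"
      then have p: "p \<in> pointings G t (Suc h)" "p [] = j" by auto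
      show "?split p c \<in> ?B c"
        using pointings_at_child[OF p(1) c] c unfolding p(2) by simp
    qed auto
    show "join_pointings ?n j ` (\<Pi>\<^sub>E c\<in>{1..?n}. ?B c) \<subseteq> {p \<in> pointings G t (Suc h). p [] = j}"
    proof (rule image_subsetI)
      fix f assume f: "f \<in> (\<Pi>\<^sub>E c\<in>{1..?n}. ?B c)"
      have "join_pointings ?n j f \<in> pointings G t (Suc h)"
        using j by (rule join_pointings_in) (rule PiE_mem[OF f])
      then show "join_pointings ?n j f \<in> {p \<in> pointings G t (Suc h). p [] = j}"
        by (simp add: join_pointings_def)
    qed
  qed
  then have "card {p \<in> pointings G t (Suc h). p [] = j} = card (\<Pi>\<^sub>E c\<in>{1..?n}. ?B c)"
    by (rule bij_betw_same_card)
  also have "\<dots> = (\<Prod>c\<in>{1..?n}. card (?B c))" by (rule card_PiE) simp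
  finally show ?thesis by (simp only: if_distrib[of card])
qed

text \<open>A cover prescribes the number of children only for types in \<^term>\<open>verts G\<close>. These numbers add
  up to the out-degree, so no child has another type.\<close>

lemma (in fin_digraph) cover_child_types:
  assumes "directed_cover G i t"
  shows "(\<lambda>c. t [c]) ` {1..out_degree G i} \<subseteq> verts G"
    and "j \<in> verts G \<Longrightarrow> card {c \<in> {1..out_degree G i}. t [c] = j} = adj G i j"
proof -
  have root: "t [] = i" and "\<forall>j\<in>verts G. card {c \<in> {1..out_degree G (t [])}. t ([] @ [c]) = j} = adj G (t []) j"
    using assms tree_nodes.root[of G t] unfolding directed_cover_def by blast+
  then have adj: "card {c \<in> {1..out_degree G i}. t [c] = j} = adj G i j" if "j \<in> verts G" for j
    using that by simp
  then show "j \<in> verts G \<Longrightarrow> card {c \<in> {1..out_degree G i}. t [c] = j} = adj G i j" .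
  let ?U = "\<Union>j\<in>verts G. {c \<in> {1..out_degree G i}. t [c] = j}"
  have "card ?U = (\<Sum>j\<in>verts G. card {c \<in> {1..out_degree G i}. t [c] = j})"
    by (rule card_UN_disjoint) auto
  also have "\<dots> = out_degree G i" 
    unfolding out_degree_eq_sum_adj[of i] by (intro sum.cong refl adj[unfolded out_degree_eq_sum_adj])
  finally have "?U = {1..out_degree G i}" by (intro card_subset_eq) auto
  then show "(\<lambda>c. t [c]) ` {1..out_degree G i} \<subseteq> verts G" by blast
qed

lemma (in fin_digraph) prod_children:
  fixes g :: "'a \<Rightarrow> 'c::comm_monoid_mult"
  assumes "directed_cover G i t"
  shows "(\<Prod>c\<in>{1..out_degree G i}. g (t [c])) = (\<Prod>j\<in>verts G. g j ^ adj G i j)"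
proof -
  have "(\<Prod>c\<in>{1..out_degree G i}. g (t [c])) =
      (\<Prod>j\<in>verts G. \<Prod>c\<in>{c \<in> {1..out_degree G i}. t [c] = j}. g (t [c]))"
    using cover_child_types(1)[OF assms] by (intro prod.group[symmetric]) auto
  also have "\<dots> = (\<Prod>j\<in>verts G. g j ^ adj G i j)"
  proof (rule prod.cong[OF refl])
    fix j assume "j \<in> verts G"
    then show "(\<Prod>c\<in>{c \<in> {1..out_degree G i}. t [c] = j}. g (t [c])) = g j ^ adj G i j"
      using cover_child_types(2)[OF assms, of j] by simp
  qed
  finally show ?thesis .
qed

lemma (in fin_digraph) sum_children:
  fixes g :: "'a \<Rightarrow> real"
  assumes "directed_cover G i t"
  shows "(\<Sum>c\<in>{1..out_degree G i}. g (t [c])) = (\<Sum>j\<in>verts G. real (adj G i j) * g j)"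
proof -
  have "(\<Sum>c\<in>{1..out_degree G i}. g (t [c])) =
      (\<Sum>j\<in>verts G. \<Sum>c\<in>{c \<in> {1..out_degree G i}. t [c] = j}. g (t [c]))"
    using cover_child_types(1)[OF assms] by (intro sum.group[symmetric]) auto
  also have "\<dots> = (\<Sum>j\<in>verts G. real (adj G i j) * g j)"
  proof (rule sum.cong[OF refl])
    fix j assume "j \<in> verts G"
    then show "(\<Sum>c\<in>{c \<in> {1..out_degree G i}. t [c] = j}. g (t [c])) = real (adj G i j) * g j"
      using cover_child_types(2)[OF assms, of j] by simp
  qed
  finally show ?thesis .
qed

lemma (in fin_digraph) card_pointings_Suc:
  assumes cover: "directed_cover G i t"
    and a: "\<And>c. c \<in> {1..out_degree G i} \<Longrightarrow> card (pointings G (subtree t c) h) = a (t [c])"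
    and b: "\<And>c. c \<in> {1..out_degree G i} \<Longrightarrow> card (up_pointings G (subtree t c) h) = b (t [c])"
  shows "card {p \<in> pointings G t (Suc h). p [] = 0} = (\<Prod>j\<in>verts G. a j ^ adj G i j)"
    and "real (card {p \<in> pointings G t (Suc h). p [] \<noteq> 0}) =
      real (\<Prod>j\<in>verts G. a j ^ adj G i j) * (\<Sum>j\<in>verts G. real (adj G i j) * real (b j) / real (a j))"
proof -
  let ?n = "out_degree G i"
  have t_root: "t [] = i" using cover by (simp add: directed_cover_def)
  have count: "card {p \<in> pointings G t (Suc h). p [] = j} =
      (\<Prod>c\<in>{1..?n}. if c = j then b (t [c]) else a (t [c]))" if "j \<le> ?n" for j
    unfolding card_pointings_root[of j G t h, unfolded t_root, OF that]
    by (rule prod.cong[OF refl]) (simp only: a b)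
  have a_pos: "0 < a (t [c])" if "c \<in> {1..?n}" for c
    using a[OF that] card_pointings_pos[of G "subtree t c" h] by simp
  let ?P = "\<Prod>c\<in>{1..?n}. a (t [c])"
  have P: "?P = (\<Prod>j\<in>verts G. a j ^ adj G i j)" by (rule prod_children[OF cover])
  have "card {p \<in> pointings G t (Suc h). p [] = 0} = ?P"
    unfolding count[OF le0] by (rule prod.cong) auto
  then show "card {p \<in> pointings G t (Suc h). p [] = 0} = (\<Prod>j\<in>verts G. a j ^ adj G i j)"
    using P by simp
  have le: "p [] \<le> ?n" if "p \<in> pointings G t (Suc h)" for p
  proof -
    have "p \<in> choices G t (Suc h)" using that by (simp add: pointings_def)
    then have "p [] \<in> {0..out_degree G (t [])}"
      unfolding choices_def by (rule PiE_mem) (simp add: Nil_in_internal)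
    then show ?thesis by (simp add: t_root)
  qed
  have "{p \<in> pointings G t (Suc h). p [] \<noteq> 0} = (\<Union>j\<in>{1..?n}. {p \<in> pointings G t (Suc h). p [] = j})"
    using le by (auto simp: Suc_le_eq)
  then have "card {p \<in> pointings G t (Suc h). p [] \<noteq> 0} =
      (\<Sum>j\<in>{1..?n}. card {p \<in> pointings G t (Suc h). p [] = j})"
    using finite_pointings[of G t "Suc h"] by (simp only:) (rule card_UN_disjoint; auto)
  also have "real \<dots> = (\<Sum>j\<in>{1..?n}. real ?P * (real (b (t [j])) / real (a (t [j]))))"
    unfolding of_nat_sum
  proof (rule sum.cong[OF refl])
    fix j assume j: "j \<in> {1..?n}"
    have "card {p \<in> pointings G t (Suc h). p [] = j} = b (t [j]) * (\<Prod>c\<in>{1..?n} - {j}. a (t [c]))"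
    proof -
      have "card {p \<in> pointings G t (Suc h). p [] = j} =
          (\<Prod>c\<in>{1..?n}. if c = j then b (t [c]) else a (t [c]))"
        using j by (intro count) simp
      also have "\<dots> = b (t [j]) * (\<Prod>c\<in>{1..?n} - {j}. if c = j then b (t [c]) else a (t [c]))"
        by (subst prod.remove[OF _ j]) auto
      also have "(\<Prod>c\<in>{1..?n} - {j}. if c = j then b (t [c]) else a (t [c])) =
          (\<Prod>c\<in>{1..?n} - {j}. a (t [c]))"
        by (rule prod.cong) auto
      finally show ?thesis .
    qed
    moreover have "?P = a (t [j]) * (\<Prod>c\<in>{1..?n} - {j}. a (t [c]))"
      by (rule prod.remove[OF _ j]) auto
    ultimately show "real (card {p \<in> pointings G t (Suc h). p [] = j}) =
        real ?P * (real (b (t [j])) / real (a (t [j])))"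
      using a_pos[OF j] by (simp del: of_nat_prod)
  qed
  also have "\<dots> = real ?P * (\<Sum>j\<in>verts G. real (adj G i j) * (real (b j) / real (a j)))"
    unfolding sum_distrib_left[symmetric] sum_children[OF cover, of "\<lambda>j. real (b j) / real (a j)"] ..
  finally show "real (card {p \<in> pointings G t (Suc h). p [] \<noteq> 0}) =
      real (\<Prod>j\<in>verts G. a j ^ adj G i j) * (\<Sum>j\<in>verts G. real (adj G i j) * real (b j) / real (a j))"
    unfolding P by simp
qed

text \<open>The subtree at a child of type j is a cover with root type j, but in general not the given cover
  \<open>T j\<close>, since its children may be listed in another order.\<close>

lemma (in fin_digraph) card_pointings_type:
  assumes T: "\<And>i. i \<in> verts G \<Longrightarrow> directed_cover G i (T i)"
    and "i \<in> verts G" "directed_cover G i t"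
  shows "card (pointings G t h) = card (pointings G (T i) h) \<and>
    card (up_pointings G t h) = card (up_pointings G (T i) h)"
  using assms(2,3)
proof (induction h arbitrary: i t)
  case 0
  then show ?case by (simp add: up_pointings_def pointings_0)
next
  case (Suc h)
  let ?a = "\<lambda>j. card (pointings G (T j) h)" and ?b = "\<lambda>j. card (up_pointings G (T j) h)"
  have sub: "card (pointings G (subtree t c) h) = ?a (t [c]) \<and>
      card (up_pointings G (subtree t c) h) = ?b (t [c])"
    if "directed_cover G i t" "c \<in> {1..out_degree G i}" for t c
    using cover_child_types(1)[OF that(1)] that by (intro Suc.IH directed_cover_subtree[of G i]) auto
  note rec = card_pointings_Suc[of i _ h ?a ?b, OF _ conjunct1[OF sub] conjunct2[OF sub]]
  have down: "card {p \<in> pointings G t (Suc h). p [] = 0} = card {p \<in> pointings G (T i) (Suc h). p [] = 0}"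
    using rec(1)[of t] rec(1)[of "T i"] Suc.prems T[of i] by simp
  have "real (card {p \<in> pointings G t (Suc h). p [] \<noteq> 0}) =
      real (card {p \<in> pointings G (T i) (Suc h). p [] \<noteq> 0})"
    using rec(2)[of t] rec(2)[of "T i"] Suc.prems T[of i] by simp
  then have up: "card {p \<in> pointings G t (Suc h). p [] \<noteq> 0} = card {p \<in> pointings G (T i) (Suc h). p [] \<noteq> 0}"
    by (simp only: of_nat_eq_iff)
  show ?case using down up card_pointings_split[of G t "Suc h"] card_pointings_split[of G "T i" "Suc h"]
    by (simp add: up_pointings_def)
qed

lemma (in fin_digraph) F_recursion:
  assumes T: "\<And>i. i \<in> verts G \<Longrightarrow> directed_cover G i (T i)" and i: "i \<in> verts G"
  shows "F_down G (T i) (Suc h) = (\<Prod>j\<in>verts G. card (pointings G (T j) h) ^ adj G i j)"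
    and "real (F_up G (T i) (Suc h)) = real (F_down G (T i) (Suc h)) *
      (\<Sum>j\<in>verts G. real (adj G i j) * real (card (up_pointings G (T j) h)) /
        real (card (pointings G (T j) h)))"
proof -
  let ?a = "\<lambda>j. card (pointings G (T j) h)" and ?b = "\<lambda>j. card (up_pointings G (T j) h)"
  interpret tree: cover_tree G "T i" "Suc h" by unfold_locales simp
  have sub: "card (pointings G (subtree (T i) c) h) = ?a (T i [c]) \<and>
      card (up_pointings G (subtree (T i) c) h) = ?b (T i [c])" if "c \<in> {1..out_degree G i}" for c
    using cover_child_types(1)[OF T[OF i]] that T i
    by (intro card_pointings_type directed_cover_subtree[of G i]) auto
  note rec = card_pointings_Suc[of i "T i" h ?a ?b, OF T[OF i] conjunct1[OF sub] conjunct2[OF sub]]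
  show "F_down G (T i) (Suc h) = (\<Prod>j\<in>verts G. ?a j ^ adj G i j)"
    unfolding tree.F_down_eq by (rule rec(1))
  then show "real (F_up G (T i) (Suc h)) = real (F_down G (T i) (Suc h)) *
      (\<Sum>j\<in>verts G. real (adj G i j) * real (?b j) / real (?a j))"
    unfolding tree.F_up_eq using rec(2) by (simp only:)
qed

theorem theorem3p3:
  fixes G :: "(nat, 'b) pre_digraph"
    and m :: nat
    and T :: "nat \<Rightarrow> nat list \<Rightarrow> nat"
  assumes "fin_digraph G"
    and "strongly_connected G"
    and "verts G = {1..m}"
    and "\<And>i. i \<in> verts G \<Longrightarrow> directed_cover G i (T i)"
  shows "(\<forall>i \<in> verts G. \<forall>h \<ge> 1.
            order (RR_wired G (T i) h) = F_down G (T i) h + F_up G (T i) h) \<and>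
         (\<forall>i \<in> verts G. F_down G (T i) 1 = 1 \<and> F_up G (T i) 1 = out_degree G i) \<and>
         (\<forall>i \<in> verts G. \<forall>h \<ge> 2.
            F_down G (T i) h =
              (\<Prod>j \<in> verts G. (F_down G (T j) (h - 1) + F_up G (T j) (h - 1)) ^ adj G i j) \<and>
            real (F_up G (T i) h) =
              real (F_down G (T i) h) *
                (\<Sum>j \<in> verts G. real (adj G i j) * real (F_up G (T j) (h - 1)) /
                   real (F_down G (T j) (h - 1) + F_up G (T j) (h - 1))))"
proof (intro conjI ballI allI impI)
  interpret fin_digraph G by fact
  note rec = F_recursion[of T, OF assms(4)]
  fix i assume i: "i \<in> verts G"
  show "order (RR_wired G (T i) h) = F_down G (T i) h + F_up G (T i) h" if "1 \<le> h" for h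
  proof -
    interpret tree: cover_tree G "T i" h using that by unfold_locales simp
    show ?thesis by (simp only: tree.order_RR_wired tree.card_recurrent tree.F_down_plus_F_up)
  qed
  have one: "card (pointings G (T j) 0) = 1" "card (up_pointings G (T j) 0) = 1" for j
    by (simp_all add: up_pointings_def pointings_0)
  show down1: "F_down G (T i) 1 = 1" using rec(1)[OF _ i, of 0] by (simp add: one)
  have "real (F_up G (T i) 1) = real (out_degree G i)"
    using rec(2)[OF _ i, of 0] down1 by (simp add: one out_degree_eq_sum_adj)
  then show "F_up G (T i) 1 = out_degree G i" by (simp only: of_nat_eq_iff)
  fix h :: nat assume "2 \<le> h"
  then obtain k where k: "h = Suc k" "0 < k" by (cases h) auto
  have counts: "card (pointings G (T j) k) = F_down G (T j) k + F_up G (T j) k"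
    "card (up_pointings G (T j) k) = F_up G (T j) k" for j
  proof -
    interpret tree: cover_tree G "T j" k using k(2) by unfold_locales
    show "card (pointings G (T j) k) = F_down G (T j) k + F_up G (T j) k"
      by (rule tree.F_down_plus_F_up[symmetric])
    show "card (up_pointings G (T j) k) = F_up G (T j) k"
      using k(2) by (simp add: tree.F_up_eq up_pointings_def)
  qed
  show "F_down G (T i) h = (\<Prod>j\<in>verts G. (F_down G (T j) (h - 1) + F_up G (T j) (h - 1)) ^ adj G i j)"
    using rec(1)[OF _ i, of k] k by (simp add: counts)
  show "real (F_up G (T i) h) = real (F_down G (T i) h) *
      (\<Sum>j\<in>verts G. real (adj G i j) * real (F_up G (T j) (h - 1)) /
        real (F_down G (T j) (h - 1) + F_up G (T j) (h - 1)))"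
    using rec(2)[OF _ i, of k] k by (simp add: counts)
qed

end
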